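(* Let $m\ge 1$, $n\ge 0$ and $k\ge 0$ be integers, and let $\nu_{2l}^{m|0}$, $l=1,2,\ldots$, be a sequence of fundamental solutions of the natural powers of $\Delta_b=-\sum_{j=1}^m\partial_{x_j}^2$ on $\mathbb{R}^m$ satisfying $\Delta_b^j\nu_{2l}^{m|0}=\nu_{2l-2j}^{m|0}$ for $j<l$ and $\Delta_b^l\nu_{2l}^{m|0}=\delta(\underline{x})$. For $l\ge 0$ put $\nu_{2l+1}^{m|0}=\partial_{\underline{x}}\nu_{2l+2}^{m|0}$. Then the function $\nu_{2k+1}^{m|2n}$ defined by $$\nu_{2k+1}^{m|2n}=\sum_{l=0}^{n-1}2\,\frac{4^l\,(l+k)!}{(n-l-1)!\,k!}\,\nu_{2l+2k+2}^{m|0}\,\underline{\grave{x}}^{2n-2l-1}-\sum_{l=0}^n\frac{4^l\,(l+k)!}{(n-l)!\,k!}\,\nu_{2l+2k+1}^{m|0}\,\underline{\grave{x}}^{2n-2l}$$ is a fundamental solution for the operator $\Delta^k\partial_x=\partial_x^{2k+1}$, where $\partial_x$ is the super Dirac operator and $\Delta=\partial_x^2$ the super Laplace operator; i.e. $\Delta^k\partial_x\,\nu_{2k+1}^{m|2n}=\delta(x)$ in the distributional sense.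
   Context: Variables: $x_1,\ldots,x_m$ are commuting real variables (coordinates on $\mathbb{R}^m$); $\grave{x}_1,\ldots,\grave{x}_{2n}$ are anticommuting variables ($\grave{x}_i\grave{x}_j=-\grave{x}_j\grave{x}_i$) generating the real Grassmann algebra $\Lambda_{2n}$; the $x_i$ commute with the $\grave{x}_j$. $\mathcal{C}$ is the real associative unital algebra generated by $e_1,\ldots,e_m,\grave{e}_1,\ldots,\grave{e}_{2n}$ with relations $e_je_k+e_ke_j=-2\delta_{jk}$, $\grave{e}_{2j}\grave{e}_{2k}-\grave{e}_{2k}\grave{e}_{2j}=0$, $\grave{e}_{2j-1}\grave{e}_{2k-1}-\grave{e}_{2k-1}\grave{e}_{2j-1}=0$, $\grave{e}_{2j-1}\grave{e}_{2k}-\grave{e}_{2k}\grave{e}_{2j-1}=\delta_{jk}$, $e_j\grave{e}_k+\grave{e}_ke_j=0$. All $e_i,\grave{e}_j$ commute with all $x_i,\grave{x}_j$. Vector variables: $\underline{x}=\sum_{i=1}^m x_ie_i$, $\underline{\grave{x}}=\sum_{j=1}^{2n}\grave{x}_j\grave{e}_j$, $x=\underline{x}+\underline{\grave{x}}$. One has $\underline{\grave{x}}^2=\sum_{j=1}^n\grave{x}_{2j-1}\grave{x}_{2j}$, and $\underline{\grave{x}}^0=1$. Operators: $\partial_{\grave{x}_j}$ is the left derivative on the Grassmann algebra ($\partial_{\grave{x}_j}(\grave{x}_kF)=\delta_{jk}F-\grave{x}_k\partial_{\grave{x}_j}F$), commuting with the $x_i$, $e_i$, $\grave{e}_i$ and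 $\partial_{x_i}$. Put $\partial_{\underline{x}}=\sum_{j=1}^m e_j\partial_{x_j}$ and $\partial_{\underline{\grave{x}}}=2\sum_{j=1}^n\left(\grave{e}_{2j}\partial_{\grave{x}_{2j-1}}-\grave{e}_{2j-1}\partial_{\grave{x}_{2j}}\right)$ (Clifford elements acting by left multiplication). The super Dirac operator is $\partial_x=\partial_{\underline{\grave{x}}}-\partial_{\underline{x}}$, and its square is the super Laplace operator $\Delta=\partial_x^2=4\sum_{j=1}^n\partial_{\grave{x}_{2j-1}}\partial_{\grave{x}_{2j}}-\sum_{j=1}^m\partial_{x_j}^2$. Distributions: operators act on elements of $\mathcal{D}'(\mathbb{R}^m)\otimes\Lambda_{2n}\otimes\mathcal{C}$, with $\partial_{x_j}$ acting in the distributional sense on the first factor. $\delta(\underline{x})$ is the Dirac distribution at the origin of $\mathbb{R}^m$, and the super Dirac distribution is $\delta(x)=\delta(\underline{x})\,\grave{x}_1\cdots\grave{x}_{2n}=\delta(\underline{x})\,\underline{\grave{x}}^{2n}/n!$. Empty sums (when $n=0$) are zero. *)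

theory Defs
  imports "HOL-Analysis.Analysis" "HOL-Analysis.Finite_Function_Topology" "HOL-Library.Type_Length"
begin

section \<open>Linear algebra over the reals\<close>

subsection \<open>Free vector spaces\<close>

definition lin_ext :: "('a \<Rightarrow> 'b::real_vector) \<Rightarrow> ('a \<Rightarrow>\<^sub>0 real) \<Rightarrow> 'b" where
  "lin_ext f p = (\<Sum>w\<in>Poly_Mapping.keys p. Poly_Mapping.lookup p w *\<^sub>R f w)"

lemma lookup_scaleR_pm [simp]:
  "Poly_Mapping.lookup (c *\<^sub>R p) w = c *\<^sub>R Poly_Mapping.lookup p w"
proof -
  have "finite {i. c *\<^sub>R Poly_Mapping.lookup p i \<noteq> 0}"
    by (rule finite_subset[OF _ finite_lookup[of p]]) auto
  then show ?thesis
    by (simp add: scaleR_poly_mapping_def)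
qed

lemma lin_ext_superset:
  assumes "finite S" "Poly_Mapping.keys p \<subseteq> S"
  shows "lin_ext f p = (\<Sum>w\<in>S. Poly_Mapping.lookup p w *\<^sub>R f w)"
  unfolding lin_ext_def
  by (rule sum.mono_neutral_left) (use assms in \<open>auto simp: in_keys_iff\<close>)

lemma linear_lin_ext: "linear (lin_ext f)"
proof (rule linearI)
  fix p q :: "'a \<Rightarrow>\<^sub>0 real" and c :: real
  let ?S = "Poly_Mapping.keys p \<union> Poly_Mapping.keys q"
  have "lin_ext f (p + q) = (\<Sum>w\<in>?S. Poly_Mapping.lookup (p + q) w *\<^sub>R f w)"
    by (rule lin_ext_superset) (use Poly_Mapping.keys_add[of p q] in auto)
  also have "\<dots> = (\<Sum>w\<in>?S. Poly_Mapping.lookup p w *\<^sub>R f w) +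
                  (\<Sum>w\<in>?S. Poly_Mapping.lookup q w *\<^sub>R f w)"
    by (simp add: lookup_add scaleR_add_left sum.distrib)
  also have "\<dots> = lin_ext f p + lin_ext f q"
    by (simp add: lin_ext_superset[of ?S])
  finally show "lin_ext f (p + q) = lin_ext f p + lin_ext f q" .
  have "lin_ext f (c *\<^sub>R p) =
      (\<Sum>w\<in>Poly_Mapping.keys p. Poly_Mapping.lookup (c *\<^sub>R p) w *\<^sub>R f w)"
    by (rule lin_ext_superset) (auto simp: in_keys_iff)
  then show "lin_ext f (c *\<^sub>R p) = c *\<^sub>R lin_ext f p"
    by (simp add: lin_ext_def scaleR_sum_right)
qed

lemma lin_ext_single [simp]: "lin_ext f (Poly_Mapping.single w c) = c *\<^sub>R f w"
  by (simp add: lin_ext_def)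

lemma pm_expand:
  "(p :: 'a \<Rightarrow>\<^sub>0 real) =
    (\<Sum>w\<in>Poly_Mapping.keys p. Poly_Mapping.lookup p w *\<^sub>R Poly_Mapping.single w 1)"
  by (rule poly_mapping_eqI)
     (simp add: lookup_sum lookup_single when_def if_distrib[of "\<lambda>x. _ * x"] sum.delta in_keys_iff
       cong: if_cong)

lemma linear_eq_pm:
  fixes f g :: "('a \<Rightarrow>\<^sub>0 real) \<Rightarrow> 'b::real_vector"
  assumes "linear f" "linear g" "\<And>w. f (Poly_Mapping.single w 1) = g (Poly_Mapping.single w 1)"
  shows "f p = g p"
  by (subst (1 2) pm_expand) (simp add: linear_sum assms linear_cmul)

lemma pm_linear_induct:
  fixes p :: "'a \<Rightarrow>\<^sub>0 real"
  assumes "subspace {p. P p}" "\<And>w. P (Poly_Mapping.single w 1)"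
  shows "P p"
proof -
  have "(\<Sum>w\<in>Poly_Mapping.keys p. Poly_Mapping.lookup p w *\<^sub>R Poly_Mapping.single w 1) \<in> {p. P p}"
    by (intro subspace_sum subspace_scale assms) (simp add: assms)
  then show ?thesis
    using pm_expand[of p] by simp
qed

subsection \<open>Tensor products\<close>

definition tensor_relators :: "('a::real_vector \<times> 'b::real_vector \<Rightarrow>\<^sub>0 real) set" where
  "tensor_relators =
    {Poly_Mapping.single (a + a', b) 1 - Poly_Mapping.single (a, b) 1
       - Poly_Mapping.single (a', b) 1 | a a' b. True} \<union>
    {Poly_Mapping.single (a, b + b') 1 - Poly_Mapping.single (a, b) 1
       - Poly_Mapping.single (a, b') 1 | a b b'. True} \<union>
    {Poly_Mapping.single (c *\<^sub>R a, b) 1 - c *\<^sub>R Poly_Mapping.single (a, b) 1 | a b c. True} \<union>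
    {Poly_Mapping.single (a, c *\<^sub>R b) 1 - c *\<^sub>R Poly_Mapping.single (a, b) 1 | a b c. True}"

definition tensor_eq ::
  "('a::real_vector \<times> 'b::real_vector \<Rightarrow>\<^sub>0 real) \<Rightarrow> ('a \<times> 'b \<Rightarrow>\<^sub>0 real) \<Rightarrow> bool" where
  "tensor_eq p q \<longleftrightarrow> p - q \<in> span tensor_relators"

lemma equivp_diff_span:
  "equivp (\<lambda>p q. p - q \<in> span (R :: 'a::real_vector set))"
proof (rule equivpI)
  show "reflp (\<lambda>p q. p - q \<in> span R)"
    by (auto simp: reflp_def span_zero)
  show "symp (\<lambda>p q. p - q \<in> span R)"
    by (auto simp: symp_def) (metis minus_diff_eq span_neg)
  show "transp (\<lambda>p q. p - q \<in> span R)"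
  proof (rule transpI)
    fix x y z assume "x - y \<in> span R" "y - z \<in> span R"
    from span_add[OF this] show "x - z \<in> span R" by simp
  qed
qed

quotient_type (overloaded) ('a, 'b) tensor =
  "'a::real_vector \<times> 'b::real_vector \<Rightarrow>\<^sub>0 real" / tensor_eq
  unfolding tensor_eq_def by (rule equivp_diff_span)

instantiation tensor :: (real_vector, real_vector) real_vector
begin

lift_definition zero_tensor :: "('a, 'b) tensor" is 0 .

lift_definition plus_tensor :: "('a, 'b) tensor \<Rightarrow> ('a, 'b) tensor \<Rightarrow> ('a, 'b) tensor" is "(+)"
  unfolding tensor_eq_def by (metis add_diff_add span_add)

lift_definition minus_tensor :: "('a, 'b) tensor \<Rightarrow> ('a, 'b) tensor \<Rightarrow> ('a, 'b) tensor" is "(-)"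
  unfolding tensor_eq_def
proof -
  fix p q r s :: "'a \<times> 'b \<Rightarrow>\<^sub>0 real"
  assume "p - q \<in> span tensor_relators" "r - s \<in> span tensor_relators"
  from span_diff[OF this] show "p - r - (q - s) \<in> span tensor_relators"
    by (simp add: algebra_simps)
qed

lift_definition uminus_tensor :: "('a, 'b) tensor \<Rightarrow> ('a, 'b) tensor" is uminus
  unfolding tensor_eq_def by (metis minus_diff_minus span_neg)

lift_definition scaleR_tensor :: "real \<Rightarrow> ('a, 'b) tensor \<Rightarrow> ('a, 'b) tensor" is scaleR
  unfolding tensor_eq_def by (metis scaleR_diff_right span_scale)

instance
  by standard (transfer, simp add: tensor_eq_def span_zero algebra_simps)+

end

lift_definition pure_tensor :: "'a::real_vector \<Rightarrow> 'b::real_vector \<Rightarrow> ('a, 'b) tensor"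
    (infixr \<open>\<otimes>\<^sub>t\<close> 75) is
  "\<lambda>a b. Poly_Mapping.single (a, b) 1" .

lemma bilinear_pure_tensor: "bilinear (\<otimes>\<^sub>t)"
  unfolding bilinear_def
proof (intro conjI allI linearI; transfer)
  fix a a' :: 'a and b b' :: 'b and c :: real
  show "tensor_eq (Poly_Mapping.single (a, b + b') 1)
          (Poly_Mapping.single (a, b) 1 + Poly_Mapping.single (a, b') 1)"
    unfolding tensor_eq_def diff_diff_eq[symmetric] tensor_relators_def
    by (rule span_base) blast
  show "tensor_eq (Poly_Mapping.single (a + a', b) 1)
          (Poly_Mapping.single (a, b) 1 + Poly_Mapping.single (a', b) 1)"
    unfolding tensor_eq_def diff_diff_eq[symmetric] tensor_relators_def
    by (rule span_base) blast
  show "tensor_eq (Poly_Mapping.single (a, c *\<^sub>R b) 1) (c *\<^sub>R Poly_Mapping.single (a, b) 1)"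
    unfolding tensor_eq_def tensor_relators_def by (rule span_base) blast
  show "tensor_eq (Poly_Mapping.single (c *\<^sub>R a, b) 1) (c *\<^sub>R Poly_Mapping.single (a, b) 1)"
    unfolding tensor_eq_def tensor_relators_def by (rule span_base) blast
qed

text \<open>The linear map out of a tensor product induced by a bilinear map; the value for
  maps that are not bilinear is irrelevant.\<close>

lift_definition tensor_lift ::
  "('a::real_vector \<Rightarrow> 'b::real_vector \<Rightarrow> 'c::real_vector) \<Rightarrow> ('a, 'b) tensor \<Rightarrow> 'c" is
  "\<lambda>f p. if bilinear f then lin_ext (\<lambda>(a, b). f a b) p else 0"
proof (unfold tensor_eq_def)
  fix f :: "'a \<Rightarrow> 'b \<Rightarrow> 'c" and p q :: "'a \<times> 'b \<Rightarrow>\<^sub>0 real"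
  assume pq: "p - q \<in> span tensor_relators"
  let ?L = "lin_ext (\<lambda>(a, b). f a b)"
  note L = linear_lin_ext[of "\<lambda>(a, b). f a b"]
  have "?L p = ?L q" if f: "bilinear f"
  proof -
    have rel: "?L r = 0" if "r \<in> tensor_relators" for r
      using that unfolding tensor_relators_def
      by (elim UnE CollectE exE conjE)
         (simp_all add: linear_diff[OF L] linear_cmul[OF L] bilinear_ladd[OF f] bilinear_radd[OF f]
          bilinear_lmul[OF f] bilinear_rmul[OF f])
    have "?L (p - q) = 0"
      by (rule linear_eq_0_on_span[OF L rel pq])
    then show ?thesis by (simp add: linear_diff[OF L])
  qed
  then show "(if bilinear f then ?L p else 0) = (if bilinear f then ?L q else 0)" by simp
qed

lemma linear_tensor_lift: "linear (tensor_lift f)"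
  by (rule linearI; transfer)
     (auto simp: linear_add[OF linear_lin_ext] linear_cmul[OF linear_lin_ext])

lemma tensor_lift_pure [simp]: "bilinear f \<Longrightarrow> tensor_lift f (a \<otimes>\<^sub>t b) = f a b"
  by transfer simp

lemma tensor_linear_induct:
  assumes "subspace {t. P t}" "\<And>a b. P (a \<otimes>\<^sub>t b)"
  shows "P t"
proof -
  have "P (abs_tensor p)" for p :: "'a \<times> 'b \<Rightarrow>\<^sub>0 real"
  proof (rule pm_linear_induct[where P = "\<lambda>p. P (abs_tensor p)"])
    show "subspace {p. P (abs_tensor p)}"
      using assms(1)
      unfolding subspace_def Ball_def mem_Collect_eq plus_tensor.abs_eq[symmetric]
        scaleR_tensor.abs_eq[symmetric] zero_tensor.abs_eq[symmetric]
      by blast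
    show "P (abs_tensor (Poly_Mapping.single w 1))" for w
      using assms(2)[of "fst w" "snd w"] by (simp add: pure_tensor.abs_eq)
  qed
  then show ?thesis by (metis Quotient3_abs_rep Quotient3_tensor)
qed

lemma linear_eq_tensor:
  assumes "linear f" "linear g" "\<And>a b. f (a \<otimes>\<^sub>t b) = g (a \<otimes>\<^sub>t b)"
  shows "f t = g t"
proof (rule tensor_linear_induct[where P = "\<lambda>t. f t = g t"])
  show "subspace {t. f t = g t}"
    using assms(1,2)
    by (auto simp: subspace_def linear_0 linear_add linear_cmul)
qed (rule assms(3))

lemma bilinear_compose_linear:
  assumes "bilinear h" "linear f" "linear g"
  shows "bilinear (\<lambda>a b. h (f a) (g b))"
  unfolding bilinear_def
proof (intro conjI allI)
  show "linear (\<lambda>b. h (f x) (g b))" for x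
    using linear_compose[OF assms(3), of "h (f x)"] assms(1) by (simp add: bilinear_def o_def)
  show "linear (\<lambda>a. h (f a) (g y))" for y
    using linear_compose[OF assms(2), of "\<lambda>a. h a (g y)"] assms(1)
    by (simp add: bilinear_def o_def)
qed

definition tensor_map ::
  "('a::real_vector \<Rightarrow> 'c::real_vector) \<Rightarrow> ('b::real_vector \<Rightarrow> 'd::real_vector) \<Rightarrow>
   ('a, 'b) tensor \<Rightarrow> ('c, 'd) tensor" where
  "tensor_map f g = tensor_lift (\<lambda>a b. f a \<otimes>\<^sub>t g b)"

lemma linear_tensor_map: "linear (tensor_map f g)"
  unfolding tensor_map_def by (rule linear_tensor_lift)

lemma tensor_map_pure [simp]:
  assumes "linear f" "linear g"
  shows "tensor_map f g (a \<otimes>\<^sub>t b) = f a \<otimes>\<^sub>t g b"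
proof -
  have "bilinear (\<lambda>a b. f a \<otimes>\<^sub>t g b)"
    by (rule bilinear_compose_linear[OF bilinear_pure_tensor assms])
  then show ?thesis by (simp add: tensor_map_def)
qed

text \<open>The tensor product of two algebras, \<open>(a \<otimes> b) (c \<otimes> d) = ac \<otimes> bd\<close>.\<close>

lemma bilinear_mult: "bilinear ((*) :: 'a::real_algebra \<Rightarrow> 'a \<Rightarrow> 'a)"
  by (auto simp: bilinear_def linear_iff algebra_simps)

lemma linear_mult_left: "linear ((*) (a :: 'a::real_algebra))"
  by (auto simp: linear_iff algebra_simps)

lemma linear_mult_right: "linear (\<lambda>b. b * (a :: 'a::real_algebra))"
  by (auto simp: linear_iff algebra_simps)

lemma bilinear_tensor_map_mult:
  "bilinear (\<lambda>a b. tensor_map ((*) (a :: 'a::real_algebra)) ((*) (b :: 'b::real_algebra)) t)"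
proof (rule tensor_linear_induct[where t = t and
      P = "\<lambda>t. bilinear (\<lambda>(a::'a) (b::'b). tensor_map ((*) a) ((*) b) t)"])
  show "subspace {t. bilinear (\<lambda>(a::'a) (b::'b). tensor_map ((*) a) ((*) b) t)}"
    unfolding subspace_def bilinear_def Ball_def mem_Collect_eq
      linear_0[OF linear_tensor_map] linear_add[OF linear_tensor_map]
      linear_cmul[OF linear_tensor_map]
    by (intro conjI ballI allI impI linear_zero linear_compose_add linear_compose_scale_right)
      auto
  show "bilinear (\<lambda>(a::'a) (b::'b). tensor_map ((*) a) ((*) b) (c \<otimes>\<^sub>t d))" for c d
    unfolding tensor_map_pure[OF linear_mult_left linear_mult_left]
    by (rule bilinear_compose_linear[OF bilinear_pure_tensor linear_mult_right linear_mult_right])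
qed

instantiation tensor :: (real_algebra, real_algebra) real_algebra
begin

definition times_tensor :: "('a, 'b) tensor \<Rightarrow> ('a, 'b) tensor \<Rightarrow> ('a, 'b) tensor" where
  "s * t = tensor_lift (\<lambda>a b. tensor_map ((*) a) ((*) b) t) s"

lemma times_tensor_linear_left: "linear (\<lambda>s. s * (t :: ('a, 'b) tensor))"
  unfolding times_tensor_def by (rule linear_tensor_lift)

lemma times_tensor_pure_left: "(a \<otimes>\<^sub>t b) * (t :: ('a, 'b) tensor) = tensor_map ((*) a) ((*) b) t"
  unfolding times_tensor_def by (rule tensor_lift_pure[OF bilinear_tensor_map_mult])

lemma times_tensor_linear_right: "linear ((*) (s :: ('a, 'b) tensor))"
proof (rule tensor_linear_induct[where P = "\<lambda>s. linear ((*) s)" and t = s])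
  show "subspace {s. linear ((*) (s :: ('a, 'b) tensor))}"
    unfolding subspace_def Ball_def mem_Collect_eq
  proof (intro conjI allI impI)
    note L = times_tensor_linear_left
    show "linear ((*) (0 :: ('a, 'b) tensor))"
      unfolding linear_0[OF L, abs_def] by (rule linear_zero)
    show "linear ((*) (x + y))" if "linear ((*) x)" "linear ((*) y)" for x y :: "('a, 'b) tensor"
      unfolding linear_add[OF L, abs_def] by (rule linear_compose_add[OF that])
    show "linear ((*) (c *\<^sub>R x))" if "linear ((*) x)" for c and x :: "('a, 'b) tensor"
      unfolding linear_cmul[OF L, abs_def] by (rule linear_compose_scale_right[OF that])
  qed
  show "linear ((*) ((a \<otimes>\<^sub>t b) :: ('a, 'b) tensor))" for a b
    unfolding times_tensor_pure_left[abs_def] by (rule linear_tensor_map)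
qed

lemma times_tensor_pure [simp]:
  "(a \<otimes>\<^sub>t b) * ((c \<otimes>\<^sub>t d) :: ('a, 'b) tensor) = (a * c) \<otimes>\<^sub>t (b * d)"
  unfolding times_tensor_pure_left
  by (rule tensor_map_pure[OF linear_mult_left linear_mult_left])

instance
proof
  fix a b c :: "('a, 'b) tensor" and r :: real
  note L = times_tensor_linear_left and R = times_tensor_linear_right
  show "(a + b) * c = a * c + b * c" by (rule linear_add[OF L])
  show "a * (b + c) = a * b + a * c" by (rule linear_add[OF R])
  show "r *\<^sub>R a * b = r *\<^sub>R (a * b)" by (rule linear_cmul[OF L])
  show "a * r *\<^sub>R b = r *\<^sub>R (a * b)" by (rule linear_cmul[OF R])
  have 1: "linear (\<lambda>a::('a, 'b) tensor. a * b * c)" for b c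
    using linear_compose[OF L[of b] L[of c]] by (simp add: o_def)
  have 2: "linear (\<lambda>b::('a, 'b) tensor. a * b * c)" for a c
    using linear_compose[OF R[of a] L[of c]] by (simp add: o_def)
  have 3: "linear (\<lambda>b::('a, 'b) tensor. a * (b * c))" for a c
    using linear_compose[OF L[of c] R[of a]] by (simp add: o_def)
  have 4: "linear (\<lambda>c::('a, 'b) tensor. a * (b * c))" for a b
    using linear_compose[OF R[of b] R[of a]] by (simp add: o_def)
  show "a * b * c = a * (b * c)"
  proof (rule linear_eq_tensor[OF 1 L])
    fix a1 a2
    show "(a1 \<otimes>\<^sub>t a2) * b * c = (a1 \<otimes>\<^sub>t a2) * (b * c)"
    proof (rule linear_eq_tensor[OF 2 3])
      fix b1 b2
      show "(a1 \<otimes>\<^sub>t a2) * (b1 \<otimes>\<^sub>t b2) * c = (a1 \<otimes>\<^sub>t a2) * ((b1 \<otimes>\<^sub>t b2) * c)"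
        by (rule linear_eq_tensor[OF R 4]) (simp add: mult.assoc)
    qed
  qed
qed

end

instantiation tensor :: ("{real_algebra, monoid_mult}", "{real_algebra, monoid_mult}") monoid_mult
begin

definition one_tensor :: "('a, 'b) tensor" where "1 = 1 \<otimes>\<^sub>t 1"

instance
proof
  fix a :: "('a, 'b) tensor"
  show "1 * a = a"
    by (rule linear_eq_tensor[OF times_tensor_linear_right linear_id[unfolded id_def]])
       (simp add: one_tensor_def)
  show "a * 1 = a"
    by (rule linear_eq_tensor[OF times_tensor_linear_left linear_id[unfolded id_def]])
       (simp add: one_tensor_def)
qed

end

section \<open>Algebras given by generators and relations\<close>

text \<open>\<open>'g list \<Rightarrow>\<^sub>0 real\<close> is the free unital associative real algebra on the generators
  \<open>'g\<close>: finitely supported functions on the monoid of words, with the convolution product.\<close>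

instantiation list :: (type) monoid_add
begin
definition zero_list :: "'a list" where "0 = []"
definition plus_list :: "'a list \<Rightarrow> 'a list \<Rightarrow> 'a list" where "xs + ys = xs @ ys"
instance by standard (auto simp: zero_list_def plus_list_def)
end

definition free_gen :: "'g \<Rightarrow> 'g list \<Rightarrow>\<^sub>0 real" where
  "free_gen g = Poly_Mapping.single [g] 1"

lemma scaleR_pm_conv: "c *\<^sub>R p = Poly_Mapping.single (0 :: 'a::monoid_add) c * (p :: 'a \<Rightarrow>\<^sub>0 real)"
  unfolding mult_map_scale_conv_mult[symmetric]
  by (rule poly_mapping_eqI) (simp add: Poly_Mapping.map.rep_eq when_def)

lemma scaleR_pm_mult_left:
  "(c *\<^sub>R p) * q = c *\<^sub>R (p * (q :: 'a::monoid_add \<Rightarrow>\<^sub>0 real))"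
  unfolding scaleR_pm_conv by (rule mult.assoc)

lemma scaleR_pm_mult_right:
  "p * (c *\<^sub>R q) = c *\<^sub>R (p * (q :: 'a::monoid_add \<Rightarrow>\<^sub>0 real))"
proof -
  have "p * Poly_Mapping.single 0 c = c *\<^sub>R p"
  proof (rule linear_eq_pm[where f = "\<lambda>p. p * Poly_Mapping.single 0 c"])
    show "linear (\<lambda>p. p * Poly_Mapping.single (0 :: 'a) c)"
      by (rule linearI) (simp_all add: ring_distribs scaleR_pm_mult_left)
    show "linear (\<lambda>p. c *\<^sub>R p)" by (rule linear_scale_self)
    show "Poly_Mapping.single w 1 * Poly_Mapping.single (0 :: 'a) c
        = c *\<^sub>R Poly_Mapping.single w 1" for w
      unfolding scaleR_pm_conv by (simp add: mult_single)
  qed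
  then have "p * Poly_Mapping.single 0 c * q = c *\<^sub>R p * q" by simp
  then show ?thesis
    unfolding scaleR_pm_mult_left scaleR_pm_conv[of c q] by (simp only: mult.assoc)
qed

class presentation =
  fixes relators :: "('a list \<Rightarrow>\<^sub>0 real) set"

text \<open>The two-sided ideal generated by the relators.\<close>

definition relator_ideal :: "('g::presentation list \<Rightarrow>\<^sub>0 real) set" where
  "relator_ideal = span {u * r * v | u r v. r \<in> relators}"

lemma relator_ideal_mult_left: "p \<in> relator_ideal \<Longrightarrow> q * p \<in> relator_ideal"
  unfolding relator_ideal_def
proof (induction rule: span_induct)
  case base
  show ?case
    by (auto simp: subspace_def span_zero span_add ring_distribs scaleR_pm_mult_right span_scale)
next
  case (step p)
  then obtain u r v where "p = u * r * v" "r \<in> relators" by blast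
  then have "q * p = (q * u) * r * v" by (simp add: mult.assoc)
  with \<open>r \<in> relators\<close> show ?case by (intro span_base) blast
qed

lemma relator_ideal_mult_right: "p \<in> relator_ideal \<Longrightarrow> p * q \<in> relator_ideal"
  unfolding relator_ideal_def
proof (induction rule: span_induct)
  case base
  show ?case
    by (auto simp: subspace_def span_zero span_add ring_distribs scaleR_pm_mult_left span_scale)
next
  case (step p)
  then obtain u r v where "p = u * r * v" "r \<in> relators" by blast
  then have "p * q = u * r * (v * q)" by (simp add: mult.assoc)
  with \<open>r \<in> relators\<close> show ?case by (intro span_base) blast
qed

lemma relators_in_ideal: "r \<in> relators \<Longrightarrow> r \<in> relator_ideal"
proof -
  assume r: "r \<in> relators"
  have "r = 1 * r * 1" by simp
  with r show "r \<in> relator_ideal" unfolding relator_ideal_def by (intro span_base) blast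
qed

lemma subspace_relator_ideal: "subspace relator_ideal"
  unfolding relator_ideal_def by simp

definition presented_eq ::
  "('g::presentation list \<Rightarrow>\<^sub>0 real) \<Rightarrow> ('g list \<Rightarrow>\<^sub>0 real) \<Rightarrow> bool" where
  "presented_eq p q \<longleftrightarrow> p - q \<in> relator_ideal"

quotient_type (overloaded) 'g presented_algebra = "'g::presentation list \<Rightarrow>\<^sub>0 real" / presented_eq
  unfolding presented_eq_def relator_ideal_def by (rule equivp_diff_span)

lemma presented_eq_refl: "p = q \<Longrightarrow> presented_eq p q"
  by (simp add: presented_eq_def subspace_0[OF subspace_relator_ideal])

instantiation presented_algebra :: (presentation) "{real_algebra, monoid_mult}"
begin

lift_definition zero_presented_algebra :: "'a presented_algebra" is 0 .

lift_definition one_presented_algebra :: "'a presented_algebra" is 1 .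

lift_definition plus_presented_algebra ::
  "'a presented_algebra \<Rightarrow> 'a presented_algebra \<Rightarrow> 'a presented_algebra" is "(+)"
  unfolding presented_eq_def add_diff_add
  by (rule subspace_add[OF subspace_relator_ideal])

lift_definition minus_presented_algebra ::
  "'a presented_algebra \<Rightarrow> 'a presented_algebra \<Rightarrow> 'a presented_algebra" is "(-)"
  unfolding presented_eq_def
proof -
  fix p q r s :: "'a list \<Rightarrow>\<^sub>0 real"
  assume "p - q \<in> relator_ideal" "r - s \<in> relator_ideal"
  from subspace_diff[OF subspace_relator_ideal this] show "p - r - (q - s) \<in> relator_ideal"
    by (simp add: algebra_simps)
qed

lift_definition uminus_presented_algebra :: "'a presented_algebra \<Rightarrow> 'a presented_algebra" is uminus
  unfolding presented_eq_def minus_diff_minus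
  by (rule subspace_neg[OF subspace_relator_ideal])

lift_definition scaleR_presented_algebra :: "real \<Rightarrow> 'a presented_algebra \<Rightarrow> 'a presented_algebra"
  is scaleR
  unfolding presented_eq_def scaleR_diff_right[symmetric]
  by (rule subspace_scale[OF subspace_relator_ideal])

lift_definition times_presented_algebra ::
  "'a presented_algebra \<Rightarrow> 'a presented_algebra \<Rightarrow> 'a presented_algebra" is "(*)"
  unfolding presented_eq_def
proof -
  fix p q r s :: "'a list \<Rightarrow>\<^sub>0 real"
  assume "p - q \<in> relator_ideal" "r - s \<in> relator_ideal"
  then have "p * (r - s) + (p - q) * s \<in> relator_ideal"
    by (intro subspace_add[OF subspace_relator_ideal] relator_ideal_mult_left
        relator_ideal_mult_right)
  then show "p * r - q * s \<in> relator_ideal" by (simp add: ring_distribs)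
qed

instance
proof
  fix a b c :: "'a presented_algebra" and r s :: real
  show "a + b + c = a + (b + c)" by transfer (rule presented_eq_refl, simp add: add.assoc)
  show "a + b = b + a" by transfer (rule presented_eq_refl, simp add: add.commute)
  show "0 + a = a" by transfer (rule presented_eq_refl, simp)
  show "- a + a = 0" by transfer (rule presented_eq_refl, simp)
  show "a - b = a + - b" by transfer (rule presented_eq_refl, simp)
  show "r *\<^sub>R (a + b) = r *\<^sub>R a + r *\<^sub>R b"
    by transfer (rule presented_eq_refl, simp add: scaleR_add_right)
  show "(r + s) *\<^sub>R a = r *\<^sub>R a + s *\<^sub>R a"
    by transfer (rule presented_eq_refl, simp add: scaleR_add_left)
  show "r *\<^sub>R s *\<^sub>R a = (r * s) *\<^sub>R a" by transfer (rule presented_eq_refl, simp)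
  show "1 *\<^sub>R a = a" by transfer (rule presented_eq_refl, simp)
  show "a * b * c = a * (b * c)" by transfer (rule presented_eq_refl, simp add: mult.assoc)
  show "(a + b) * c = a * c + b * c" by transfer (rule presented_eq_refl, simp add: distrib_right)
  show "a * (b + c) = a * b + a * c" by transfer (rule presented_eq_refl, simp add: distrib_left)
  show "r *\<^sub>R a * b = r *\<^sub>R (a * b)"
    by transfer (rule presented_eq_refl, simp add: scaleR_pm_mult_left)
  show "a * r *\<^sub>R b = r *\<^sub>R (a * b)"
    by transfer (rule presented_eq_refl, simp add: scaleR_pm_mult_right)
  show "1 * a = a" by transfer (rule presented_eq_refl, simp)
  show "a * 1 = a" by transfer (rule presented_eq_refl, simp)
qed

end

lift_definition generator :: "'g::presentation \<Rightarrow> 'g presented_algebra" is free_gen .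

subsection \<open>The Grassmann algebra on \<open>2n\<close> generators\<close>

text \<open>The number \<open>n\<close> is \<open>LENGTH('n)\<close>, which may be \<open>0\<close>. As a type of generators cannot be empty,
  the generators are indexed by all natural numbers and the relations annihilate those
  whose index lies outside \<open>{1..2n}\<close>.\<close>

datatype 'n grassmann_gen = Odd nat

instantiation grassmann_gen :: (len0) presentation
begin

definition relators_grassmann_gen :: "('a grassmann_gen list \<Rightarrow>\<^sub>0 real) set" where
  "relators =
    {free_gen (Odd i) * free_gen (Odd j) + free_gen (Odd j) * free_gen (Odd i) | i j.
       i \<in> {1..2 * LENGTH('a)} \<and> j \<in> {1..2 * LENGTH('a)}} \<union>
    {free_gen (Odd i) | i. i \<notin> {1..2 * LENGTH('a)}}"

instance ..

end

type_synonym 'n grassmann = "'n grassmann_gen presented_algebra"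

fun word_deriv :: "nat \<Rightarrow> 'n::len0 grassmann_gen list \<Rightarrow> ('n grassmann_gen list \<Rightarrow>\<^sub>0 real)" where
  "word_deriv j [] = 0"
| "word_deriv j (g # w) =
    (if g = Odd j \<and> j \<in> {1..2 * LENGTH('n)} then Poly_Mapping.single w 1 else 0)
      - free_gen g * word_deriv j w"

lemma free_deriv_gen_mult:
  "lin_ext (word_deriv j) (free_gen g * p) =
    (if g = Odd j \<and> j \<in> {1..2 * LENGTH('n)} then p else 0)
      - free_gen g * lin_ext (word_deriv j) (p :: 'n::len0 grassmann_gen list \<Rightarrow>\<^sub>0 real)"
    (is "?D (free_gen g * p) = ?d p - _")
proof (rule linear_eq_pm[where f = "\<lambda>p. ?D (free_gen g * p)"])
  note L = linear_lin_ext[of "word_deriv j"]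
  show "linear (\<lambda>p. ?D (free_gen g * p))" "linear (\<lambda>p. ?d p - free_gen g * ?D p)"
    by (auto simp: linear_iff ring_distribs scaleR_pm_mult_right linear_add[OF L]
        linear_cmul[OF L] scaleR_diff_right)
  show "?D (free_gen g * Poly_Mapping.single w 1) =
      ?d (Poly_Mapping.single w 1) - free_gen g * ?D (Poly_Mapping.single w 1)" for w
    by (simp add: free_gen_def mult_single plus_list_def)
qed

lemma free_deriv_relator_mult:
  assumes "r \<in> (relators :: ('n::len0 grassmann_gen list \<Rightarrow>\<^sub>0 real) set)"
  shows "lin_ext (word_deriv j) (r * p) \<in> relator_ideal"
proof -
  let ?D = "lin_ext (word_deriv j :: 'n grassmann_gen list \<Rightarrow> _)"
  note L = linear_lin_ext[of "word_deriv j"]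
  have "?D (r * p) = r * ?D p \<or> ?D (r * p) = - (r * ?D p)"
    using assms unfolding relators_grassmann_gen_def
    by (auto simp: free_deriv_gen_mult ring_distribs mult.assoc linear_add[OF L] split: if_splits)
  moreover have "r * ?D p \<in> relator_ideal"
    by (intro relator_ideal_mult_right relators_in_ideal assms)
  ultimately show ?thesis
    using subspace_neg[OF subspace_relator_ideal] by metis
qed

lemma free_deriv_ideal:
  assumes "p \<in> (relator_ideal :: ('n::len0 grassmann_gen list \<Rightarrow>\<^sub>0 real) set)"
  shows "lin_ext (word_deriv j) p \<in> relator_ideal"
proof -
  let ?D = "lin_ext (word_deriv j :: 'n grassmann_gen list \<Rightarrow> _)"
  note L = linear_lin_ext[of "word_deriv j"]
  have word: "?D (Poly_Mapping.single w 1 * (r * v)) \<in> relator_ideal"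
    if r: "r \<in> relators" for w r v
  proof (induction w)
    case Nil
    have "(Poly_Mapping.single [] 1 :: 'n grassmann_gen list \<Rightarrow>\<^sub>0 real) = 1"
      by (metis single_one zero_list_def)
    then show ?case using free_deriv_relator_mult[OF r] by simp
  next
    case (Cons g w)
    let ?X = "Poly_Mapping.single w 1 * (r * v)"
    have "Poly_Mapping.single (g # w) (1::real) = free_gen g * Poly_Mapping.single w 1"
      by (simp add: free_gen_def mult_single plus_list_def)
    then have eq: "Poly_Mapping.single (g # w) 1 * (r * v) = free_gen g * ?X"
      by (simp add: mult.assoc)
    have "?X \<in> relator_ideal"
      by (intro relator_ideal_mult_left relator_ideal_mult_right relators_in_ideal r)
    then show ?case
      unfolding eq free_deriv_gen_mult
      by (intro subspace_diff[OF subspace_relator_ideal] relator_ideal_mult_left Cons.IH)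
         (simp add: subspace_0[OF subspace_relator_ideal])
  qed
  have gens: "?D (u * (r * v)) \<in> relator_ideal" if r: "r \<in> relators" for u r v
  proof (rule pm_linear_induct[where P = "\<lambda>u. ?D (u * (r * v)) \<in> relator_ideal"])
    show "subspace {u. ?D (u * (r * v)) \<in> relator_ideal}"
      using subspace_relator_ideal
      unfolding subspace_def Ball_def mem_Collect_eq distrib_right scaleR_pm_mult_left mult_zero_left
        linear_add[OF L] linear_cmul[OF L] linear_0[OF L]
      by blast
  qed (rule word[OF r])
  show ?thesis
    using assms unfolding relator_ideal_def
  proof (induction rule: span_induct)
    case base
    show ?case
      by (simp add: subspace_def linear_add[OF L] linear_cmul[OF L] linear_0[OF L]
          span_zero span_add span_scale)
  next
    case (step p)
    then obtain u r v where "p = u * (r * v)" "r \<in> relators"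
      by (auto simp: mult.assoc)
    then show ?case
      using gens by (simp add: relator_ideal_def)
  qed
qed

lift_definition grassmann_deriv :: "nat \<Rightarrow> 'n::len0 grassmann \<Rightarrow> 'n grassmann" is
  "\<lambda>j. lin_ext (word_deriv j)"
  unfolding presented_eq_def
  by (metis free_deriv_ideal linear_diff[OF linear_lin_ext])

lemma linear_grassmann_deriv: "linear (grassmann_deriv j)"
  by (rule linearI; transfer)
     (auto simp: presented_eq_def subspace_0[OF subspace_relator_ideal]
       linear_add[OF linear_lin_ext] linear_cmul[OF linear_lin_ext])

text \<open>Together with linearity, the next two facts characterize the left derivative.\<close>

lemma grassmann_deriv_one: "grassmann_deriv j 1 = 0"
proof (transfer, unfold presented_eq_def)
  fix j
  have one: "(1 :: 'a grassmann_gen list \<Rightarrow>\<^sub>0 real) = Poly_Mapping.single [] 1"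
    by (metis single_one zero_list_def)
  have "lin_ext (word_deriv j) (1 :: 'a grassmann_gen list \<Rightarrow>\<^sub>0 real) = 0"
    unfolding one by simp
  then show "lin_ext (word_deriv j) 1 - 0 \<in> (relator_ideal :: ('a grassmann_gen list \<Rightarrow>\<^sub>0 real) set)"
    by (simp add: subspace_0[OF subspace_relator_ideal])
qed

lemma grassmann_deriv_gen_mult:
  assumes "j \<in> {1..2 * LENGTH('n)}"
  shows "grassmann_deriv j (generator (Odd k) * F) =
    (if j = k then F else 0) - generator (Odd k) * grassmann_deriv j (F :: 'n::len0 grassmann)"
  using assms
  by (transfer)
     (simp add: presented_eq_def free_deriv_gen_mult subspace_0[OF subspace_relator_ideal])

subsection \<open>The orthosymplectic Clifford algebra\<close>

text \<open>\<open>Ortho j\<close> stands for the orthogonal generator \<open>e_j\<close>, indexed by the type \<open>'m\<close> with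
  \<open>CARD('m) = m\<close>, and \<open>Sympl j\<close> for the symplectic generator with index \<open>j \<in> {1..2n}\<close>; those with
  index outside this range are again annihilated.\<close>

datatype ('m, 'n) clifford_gen = Ortho 'm | Sympl nat

instantiation clifford_gen :: (type, len0) presentation
begin

definition relators_clifford_gen :: "(('a, 'b) clifford_gen list \<Rightarrow>\<^sub>0 real) set" where
  "relators =
    {free_gen (Ortho j) * free_gen (Ortho k) + free_gen (Ortho k) * free_gen (Ortho j)
       - (if j = k then -2 else 0) *\<^sub>R 1 | j k. True} \<union>
    {free_gen (Sympl (2 * j)) * free_gen (Sympl (2 * k))
       - free_gen (Sympl (2 * k)) * free_gen (Sympl (2 * j)) | j k.
       j \<in> {1..LENGTH('b)} \<and> k \<in> {1..LENGTH('b)}} \<union>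
    {free_gen (Sympl (2 * j - 1)) * free_gen (Sympl (2 * k - 1))
       - free_gen (Sympl (2 * k - 1)) * free_gen (Sympl (2 * j - 1)) | j k.
       j \<in> {1..LENGTH('b)} \<and> k \<in> {1..LENGTH('b)}} \<union>
    {free_gen (Sympl (2 * j - 1)) * free_gen (Sympl (2 * k))
       - free_gen (Sympl (2 * k)) * free_gen (Sympl (2 * j - 1))
       - (if j = k then 1 else 0) *\<^sub>R 1 | j k.
       j \<in> {1..LENGTH('b)} \<and> k \<in> {1..LENGTH('b)}} \<union>
    {free_gen (Ortho j) * free_gen (Sympl k) + free_gen (Sympl k) * free_gen (Ortho j) | j k.
       k \<in> {1..2 * LENGTH('b)}} \<union>
    {free_gen (Sympl k) | k. k \<notin> {1..2 * LENGTH('b)}}"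

instance ..

end

type_synonym ('m, 'n) clifford = "('m, 'n) clifford_gen presented_algebra"

section \<open>Distributions on \<open>\<real>\<^sup>m\<close>\<close>

subsection \<open>Test functions\<close>

definition partial_deriv :: "'m::finite \<Rightarrow> (real ^ 'm \<Rightarrow> real) \<Rightarrow> real ^ 'm \<Rightarrow> real" where
  "partial_deriv j f x = frechet_derivative f (at x) (axis j 1)"

definition iter_partial :: "'m::finite list \<Rightarrow> (real ^ 'm \<Rightarrow> real) \<Rightarrow> real ^ 'm \<Rightarrow> real" where
  "iter_partial js f = foldr partial_deriv js f"

text \<open>Every iterated partial derivative is differentiable, hence continuous, so this is
  \<open>C\<^sup>\<infinity>\<close>.\<close>

definition smooth :: "(real ^ 'm::finite \<Rightarrow> real) \<Rightarrow> bool" where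
  "smooth f \<longleftrightarrow> (\<forall>js x. iter_partial js f differentiable (at x))"

definition supp :: "(real ^ 'm::finite \<Rightarrow> real) \<Rightarrow> (real ^ 'm) set" where
  "supp f = closure {x. f x \<noteq> 0}"

lemma partial_deriv_eqI:
  "(f has_derivative f') (at x) \<Longrightarrow> partial_deriv j f x = f' (axis j 1)"
  unfolding partial_deriv_def by (metis frechet_derivative_at)

lemma smooth_differentiable: "smooth f \<Longrightarrow> iter_partial js f differentiable (at x)"
  by (simp add: smooth_def)

lemma partial_deriv_zero: "partial_deriv j (\<lambda>x. 0) = (\<lambda>x. 0)"
  by (rule ext) (simp add: partial_deriv_eqI[OF has_derivative_const])

lemma partial_deriv_add:
  assumes "\<And>x. f differentiable (at x)" "\<And>x. g differentiable (at x)"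
  shows "partial_deriv j (\<lambda>x. f x + g x) = (\<lambda>x. partial_deriv j f x + partial_deriv j g x)"
proof
  fix x
  obtain f' g' where *: "(f has_derivative f') (at x)" "(g has_derivative g') (at x)"
    using assms unfolding differentiable_def by blast
  show "partial_deriv j (\<lambda>x. f x + g x) x = partial_deriv j f x + partial_deriv j g x"
    using partial_deriv_eqI[OF has_derivative_add[OF *]] partial_deriv_eqI[OF *(1)]
      partial_deriv_eqI[OF *(2)] by simp
qed

lemma partial_deriv_scale:
  assumes "\<And>x. f differentiable (at x)"
  shows "partial_deriv j (\<lambda>x. c * f x) = (\<lambda>x. c * partial_deriv j f x)"
proof
  fix x
  obtain f' where *: "(f has_derivative f') (at x)"
    using assms unfolding differentiable_def by blast
  show "partial_deriv j (\<lambda>x. c * f x) x = c * partial_deriv j f x"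
    using partial_deriv_eqI[OF has_derivative_mult_right[OF *]] partial_deriv_eqI[OF *] by simp
qed

lemma iter_partial_simps [simp]:
  "iter_partial [] f = f"
  "iter_partial (j # js) f = partial_deriv j (iter_partial js f)"
  by (simp_all add: iter_partial_def)

lemma iter_partial_partial_deriv: "iter_partial js (partial_deriv j f) = iter_partial (js @ [j]) f"
  by (simp add: iter_partial_def)

lemma iter_partial_zero: "iter_partial js (\<lambda>x. 0) = (\<lambda>x. 0)"
  by (induction js) (simp_all add: partial_deriv_zero)

lemma iter_partial_add:
  assumes "smooth f" "smooth g"
  shows "iter_partial js (\<lambda>x. f x + g x) = (\<lambda>x. iter_partial js f x + iter_partial js g x)"
  by (induction js) (simp_all add: partial_deriv_add smooth_differentiable assms)

lemma iter_partial_scale: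
  assumes "smooth f"
  shows "iter_partial js (\<lambda>x. c * f x) = (\<lambda>x. c * iter_partial js f x)"
  by (induction js) (simp_all add: partial_deriv_scale smooth_differentiable assms)

lemma smooth_zero: "smooth (\<lambda>x. 0)"
  by (simp add: smooth_def iter_partial_zero)

lemma smooth_add: "smooth f \<Longrightarrow> smooth g \<Longrightarrow> smooth (\<lambda>x. f x + g x)"
  unfolding smooth_def[of "\<lambda>x. f x + g x"]
  by (simp add: iter_partial_add smooth_differentiable differentiable_add)

lemma smooth_scale: "smooth f \<Longrightarrow> smooth (\<lambda>x. c * f x)"
  unfolding smooth_def[of "\<lambda>x. c * f x"]
  by (simp add: iter_partial_scale smooth_differentiable differentiable_mult)

lemma smooth_partial_deriv: "smooth f \<Longrightarrow> smooth (partial_deriv j f)"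
  unfolding smooth_def iter_partial_partial_deriv by blast

lemma supp_subsetI: "{x. f x \<noteq> 0} \<subseteq> supp g \<Longrightarrow> supp f \<subseteq> supp g"
  unfolding supp_def by (rule closure_minimal) auto

lemma supp_add: "supp (\<lambda>x. f x + g x) \<subseteq> supp f \<union> supp g"
proof -
  have "closure {x. f x + g x \<noteq> 0} \<subseteq> closure ({x. f x \<noteq> 0} \<union> {x. g x \<noteq> 0})"
    by (rule closure_mono) auto
  then show ?thesis by (simp add: supp_def closure_Un)
qed

lemma supp_scale: "supp (\<lambda>x. c * f x) \<subseteq> supp f"
  unfolding supp_def by (rule closure_mono) auto

lemma supp_partial_deriv: "supp (partial_deriv j f) \<subseteq> supp f"
proof (rule supp_subsetI, rule subsetI, rule ccontr)
  fix x assume x: "x \<in> {x. partial_deriv j f x \<noteq> 0}" "x \<notin> supp f"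
  have "(f has_derivative (\<lambda>_. 0)) (at x)"
  proof (rule has_derivative_transform_within_open[where f = "\<lambda>_. 0"])
    show "open (- supp f)" unfolding supp_def by (intro open_Compl closed_closure)
    show "x \<in> - supp f" using x by simp
    show "0 = f y" if "y \<in> - supp f" for y
      using that closure_subset[of "{x. f x \<noteq> 0}"] by (auto simp: supp_def)
  qed simp
  from partial_deriv_eqI[OF this] x show False by simp
qed

lemma compact_supp_subset: "supp f \<subseteq> K \<Longrightarrow> compact K \<Longrightarrow> compact (supp f)"
  by (metis closed_closure compact_Int_closed inf.absorb_iff2 supp_def)

typedef 'm test_fun = "{f :: real ^ 'm::finite \<Rightarrow> real. smooth f \<and> compact (supp f)}"
  morphisms test_app Abs_test_fun
  by (rule exI[of _ "\<lambda>x. 0"]) (simp add: smooth_zero supp_def)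

setup_lifting type_definition_test_fun

instantiation test_fun :: (finite) real_vector
begin

lift_definition zero_test_fun :: "'a test_fun" is "\<lambda>x. 0"
  by (simp add: smooth_zero supp_def)

lift_definition plus_test_fun :: "'a test_fun \<Rightarrow> 'a test_fun \<Rightarrow> 'a test_fun" is
  "\<lambda>f g x. f x + g x"
  by (metis compact_Un compact_supp_subset smooth_add supp_add)

lift_definition scaleR_test_fun :: "real \<Rightarrow> 'a test_fun \<Rightarrow> 'a test_fun" is
  "\<lambda>c f x. c * f x"
  by (metis compact_supp_subset smooth_scale supp_scale)

definition uminus_test_fun :: "'a test_fun \<Rightarrow> 'a test_fun" where
  "- f = (-1) *\<^sub>R f" for f :: "'a test_fun"

definition minus_test_fun :: "'a test_fun \<Rightarrow> 'a test_fun \<Rightarrow> 'a test_fun" where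
  "f - g = f + (- g)" for f g :: "'a test_fun"

instance
  by standard
     ((simp add: minus_test_fun_def uminus_test_fun_def)?;
      transfer; simp add: fun_eq_iff algebra_simps)+

end

lift_definition test_partial :: "'m::finite \<Rightarrow> 'm test_fun \<Rightarrow> 'm test_fun" is partial_deriv
  by (metis compact_supp_subset smooth_partial_deriv supp_partial_deriv)

text \<open>Convergence to \<open>0\<close> in the space of test functions: supports in a common compact set
  and uniform convergence of all derivatives.\<close>

definition test_null_sequence :: "(nat \<Rightarrow> 'm::finite test_fun) \<Rightarrow> bool" where
  "test_null_sequence \<phi> \<longleftrightarrow>
    (\<exists>K. compact K \<and> (\<forall>i. supp (test_app (\<phi> i)) \<subseteq> K)) \<and>
    (\<forall>js. uniform_limit UNIV (\<lambda>i. iter_partial js (test_app (\<phi> i))) (\<lambda>_. 0) sequentially)"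

subsection \<open>Distributions\<close>

text \<open>On the space of test functions, sequential continuity of a linear functional is the same as
  continuity.\<close>

typedef 'm distr =
  "{u :: 'm::finite test_fun \<Rightarrow> real. linear u \<and>
     (\<forall>\<phi>. test_null_sequence \<phi> \<longrightarrow> (\<lambda>i. u (\<phi> i)) \<longlonglongrightarrow> 0)}"
  morphisms distr_app Abs_distr
  by (rule exI[of _ "\<lambda>_. 0"]) (simp add: linear_zero)

setup_lifting type_definition_distr

instantiation distr :: (finite) real_vector
begin

lift_definition zero_distr :: "'a distr" is "\<lambda>_. 0"
  by (simp add: linear_zero)

lift_definition plus_distr :: "'a distr \<Rightarrow> 'a distr \<Rightarrow> 'a distr" is "\<lambda>u v \<phi>. u \<phi> + v \<phi>"
  by (auto intro: linear_compose_add tendsto_add_zero)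

lift_definition scaleR_distr :: "real \<Rightarrow> 'a distr \<Rightarrow> 'a distr" is "\<lambda>c u \<phi>. c *\<^sub>R u \<phi>"
  by (auto simp: linear_iff algebra_simps intro: tendsto_mult_right_zero)

definition uminus_distr :: "'a distr \<Rightarrow> 'a distr" where
  "- u = (-1) *\<^sub>R u" for u :: "'a distr"

definition minus_distr :: "'a distr \<Rightarrow> 'a distr \<Rightarrow> 'a distr" where
  "u - v = u + (- v)" for u v :: "'a distr"

instance
  by standard
     ((simp add: minus_distr_def uminus_distr_def)?;
      transfer; simp add: fun_eq_iff algebra_simps)+

end

lemma linear_test_partial: "linear (test_partial j)"
  by (rule linearI; transfer)
     (auto simp: partial_deriv_add partial_deriv_scale
       smooth_differentiable[where js = "[]", simplified])

lemma test_null_sequence_partial: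
  assumes "test_null_sequence \<phi>"
  shows "test_null_sequence (\<lambda>i. test_partial j (\<phi> i))"
  using assms supp_partial_deriv
  unfolding test_null_sequence_def test_partial.rep_eq iter_partial_partial_deriv
  by (meson subset_trans)

lift_definition distr_partial :: "'m::finite \<Rightarrow> 'm distr \<Rightarrow> 'm distr" is
  "\<lambda>j u \<phi>. - u (test_partial j \<phi>)"
proof (intro conjI allI impI; elim conjE)
  fix j :: 'm and u :: "'m test_fun \<Rightarrow> real" and \<phi> :: "nat \<Rightarrow> 'm test_fun"
  assume u: "linear u" and c: "\<forall>\<phi>. test_null_sequence \<phi> \<longrightarrow> (\<lambda>i. u (\<phi> i)) \<longlonglongrightarrow> 0"
  show "linear (\<lambda>\<phi>. - u (test_partial j \<phi>))"
    using linear_compose[OF linear_test_partial u]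
    by (simp add: o_def linear_compose_neg)
  assume "test_null_sequence \<phi>"
  with c test_null_sequence_partial[of \<phi> j] have "(\<lambda>i. u (test_partial j (\<phi> i))) \<longlonglongrightarrow> 0"
    by blast
  from tendsto_minus[OF this] show "(\<lambda>i. - u (test_partial j (\<phi> i))) \<longlonglongrightarrow> 0" by simp
qed

lift_definition dirac_delta :: "'m::finite distr" is "\<lambda>\<phi>. test_app \<phi> 0"
proof (intro conjI allI impI)
  show "linear (\<lambda>\<phi> :: 'm test_fun. test_app \<phi> 0)"
    by (rule linearI) (simp_all add: plus_test_fun.rep_eq scaleR_test_fun.rep_eq)
  fix \<phi> :: "nat \<Rightarrow> 'm test_fun"
  assume "test_null_sequence \<phi>"
  then have "uniform_limit UNIV (\<lambda>i. iter_partial [] (test_app (\<phi> i))) (\<lambda>_. 0) sequentially"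
    unfolding test_null_sequence_def by blast
  from tendsto_uniform_limitI[OF this, of 0] show "(\<lambda>i. test_app (\<phi> i) 0) \<longlonglongrightarrow> 0" by simp
qed

lemma linear_distr_partial: "linear (distr_partial j)"
  by (rule linearI; transfer) (auto simp: fun_eq_iff)

definition bosonic_laplace :: "'m::finite distr \<Rightarrow> 'm distr" where
  "bosonic_laplace u = - (\<Sum>j\<in>UNIV. distr_partial j (distr_partial j u))"

section \<open>Superanalysis with \<open>m\<close> commuting and \<open>2n\<close> anticommuting variables\<close>

type_synonym ('m, 'n) superalg = "('n grassmann, ('m, 'n) clifford) tensor"

type_synonym ('m, 'n) superdistr = "('m distr, ('m, 'n) superalg) tensor"

definition odd_var :: "nat \<Rightarrow> ('m, 'n::len0) superalg" where
  "odd_var j = generator (Odd j) \<otimes>\<^sub>t 1"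

definition ortho_e :: "'m \<Rightarrow> ('m, 'n::len0) superalg" where
  "ortho_e j = 1 \<otimes>\<^sub>t generator (Ortho j)"

definition sympl_e :: "nat \<Rightarrow> ('m, 'n::len0) superalg" where
  "sympl_e j = 1 \<otimes>\<^sub>t generator (Sympl j)"

definition fermionic_vec :: "('m, 'n::len0) superalg" where
  "fermionic_vec = (\<Sum>j = 1..2 * LENGTH('n). odd_var j * sympl_e j)"

definition embed_distr :: "'m::finite distr \<Rightarrow> ('m, 'n::len0) superdistr" where
  "embed_distr u = u \<otimes>\<^sub>t 1"

definition lmult ::
  "('m::finite, 'n::len0) superalg \<Rightarrow> ('m, 'n) superdistr \<Rightarrow> ('m, 'n) superdistr"
  (infixr \<open>\<cdot>\<^sub>l\<close> 76) where
  "a \<cdot>\<^sub>l T = tensor_map (\<lambda>u. u) (\<lambda>b. a * b) T"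

definition rmult ::
  "('m::finite, 'n::len0) superdistr \<Rightarrow> ('m, 'n) superalg \<Rightarrow> ('m, 'n) superdistr"
  (infixl \<open>\<cdot>\<^sub>r\<close> 76) where
  "T \<cdot>\<^sub>r a = tensor_map (\<lambda>u. u) (\<lambda>b. b * a) T"

definition partial_x :: "'m::finite \<Rightarrow> ('m, 'n::len0) superdistr \<Rightarrow> ('m, 'n) superdistr" where
  "partial_x j = tensor_map (distr_partial j) (\<lambda>a. a)"

definition partial_odd :: "nat \<Rightarrow> ('m::finite, 'n::len0) superdistr \<Rightarrow> ('m, 'n) superdistr" where
  "partial_odd j = tensor_map (\<lambda>u. u) (tensor_map (grassmann_deriv j) (\<lambda>c. c))"

definition bosonic_dirac :: "('m::finite, 'n::len0) superdistr \<Rightarrow> ('m, 'n) superdistr" where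
  "bosonic_dirac T = (\<Sum>j\<in>UNIV. ortho_e j \<cdot>\<^sub>l partial_x j T)"

definition fermionic_dirac :: "('m::finite, 'n::len0) superdistr \<Rightarrow> ('m, 'n) superdistr" where
  "fermionic_dirac T =
    2 *\<^sub>R (\<Sum>j = 1..LENGTH('n). sympl_e (2 * j) \<cdot>\<^sub>l partial_odd (2 * j - 1) T
                                - sympl_e (2 * j - 1) \<cdot>\<^sub>l partial_odd (2 * j) T)"

definition super_dirac :: "('m::finite, 'n::len0) superdistr \<Rightarrow> ('m, 'n) superdistr" where
  "super_dirac T = fermionic_dirac T - bosonic_dirac T"

definition super_laplace :: "('m::finite, 'n::len0) superdistr \<Rightarrow> ('m, 'n) superdistr" where
  "super_laplace = super_dirac ^^ 2"

definition super_delta :: "('m::finite, 'n::len0) superdistr" where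
  "super_delta = dirac_delta \<otimes>\<^sub>t prod_list (map odd_var [1..<2 * LENGTH('n) + 1])"

text \<open>In the following two definitions, \<open>\<nu> i\<close> is the scalar distribution \<open>\<nu>\<^sub>i\<close> for even
  \<open>i \<ge> 2\<close>, and \<open>bosonic_odd \<nu> l\<close> is the Clifford-valued distribution of index \<open>2l + 1\<close>.\<close>

definition bosonic_odd ::
  "(nat \<Rightarrow> 'm::finite distr) \<Rightarrow> nat \<Rightarrow> ('m, 'n::len0) superdistr" where
  "bosonic_odd \<nu> l = bosonic_dirac (embed_distr (\<nu> (2 * l + 2)))"

definition super_odd ::
  "(nat \<Rightarrow> 'm::finite distr) \<Rightarrow> nat \<Rightarrow> ('m, 'n::len0) superdistr" where
  "super_odd \<nu> k = (let n = LENGTH('n) in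
     (\<Sum>l<n. (2 * (4 ^ l * fact (l + k) / (fact (n - l - 1) * fact k))) *\<^sub>R
        (embed_distr (\<nu> (2 * l + 2 * k + 2)) \<cdot>\<^sub>r fermionic_vec ^ (2 * n - 2 * l - 1)))
   - (\<Sum>l\<le>n. (4 ^ l * fact (l + k) / (fact (n - l) * fact k)) *\<^sub>R
        (bosonic_odd \<nu> (l + k) \<cdot>\<^sub>r fermionic_vec ^ (2 * n - 2 * l))))"

end

theory Submission
  imports Defs
begin

text \<open>The Dirac operator acts on the elements \<open>u \<otimes> f ^ p\<close>, where \<open>f\<close> is the fermionic vector
  variable, and on their images under the bosonic Dirac operator \<open>B\<close> in a closed way: \<open>B\<close>
  squares to the bosonic Laplacian (this uses the symmetry of second derivatives) and
  anticommutes with the fermionic Dirac operator \<open>D\<close>, while \<open>D (f ^ (2 * s)) = 2 * s * f ^ (2 * s - 1)\<close>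
  and \<open>D (f ^ (2 * s + 1)) = (2 * s - 2 * n) * f ^ (2 * s)\<close>. Interleaving the given family with
  the even fundamental solutions \<open>\<mu> (2 * k + 2)\<close>
  (the constant \<open>super_even \<nu> k\<close>), one Dirac step maps \<open>\<mu> (2 * k + 2)\<close> to the fundamental solution of index
  \<open>2 * k + 1\<close> and, the bosonic contributions cancelling and the rest telescoping, that one to
  \<open>\<mu> (2 * k)\<close>, or to the Dirac distribution if \<open>k = 0\<close>. The last case rests on
  \<open>f ^ (2 * n) = n! * x\<^sub>1 \<cdots> x\<^sub>2\<^sub>n\<close>.\<close>

section \<open>Symmetry of second derivatives\<close>

text \<open>Reduces partial derivatives to one real variable, so that the one-dimensional mean value
  theorem applies.\<close>

lemma partial_deriv_along_axis:
  assumes "f differentiable (at (y + s *\<^sub>R axis j 1))"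
  shows "((\<lambda>s. f (y + s *\<^sub>R axis j 1)) has_real_derivative
      partial_deriv j f (y + s *\<^sub>R axis j 1)) (at s)"
proof -
  let ?g = "\<lambda>s. y + s *\<^sub>R axis j 1"
  let ?D = "frechet_derivative f (at (?g s))"
  have f: "(f has_derivative ?D) (at (?g s))"
    using assms by (simp add: frechet_derivative_works)
  have "(?g has_derivative (\<lambda>h. h *\<^sub>R axis j 1)) (at s)"
    by (auto intro!: derivative_eq_intros)
  from has_derivative_compose[OF this f]
  have "((\<lambda>s. f (?g s)) has_derivative (\<lambda>h. ?D (h *\<^sub>R axis j 1))) (at s)" .
  moreover have "(\<lambda>h. ?D (h *\<^sub>R axis j 1)) = (*) (partial_deriv j f (?g s))"
    using linear_cmul[OF has_derivative_linear[OF f]]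
    by (auto simp: partial_deriv_def)
  ultimately show ?thesis
    by (simp add: has_field_derivative_def)
qed

text \<open>The left-hand side is symmetric in \<open>i\<close> and \<open>j\<close>; comparing the two resulting expressions as
  \<open>h\<close> tends to \<open>0\<close> gives the symmetry.\<close>

lemma second_difference_mean_value:
  fixes f :: "real ^ 'm::finite \<Rightarrow> real"
  assumes f: "smooth f" and "h > 0"
  obtains s t where "0 < s" "s < h" "0 < t" "t < h"
    "f (x + h *\<^sub>R axis i 1 + h *\<^sub>R axis j 1) - f (x + h *\<^sub>R axis i 1) - f (x + h *\<^sub>R axis j 1) + f x
      = h * h * partial_deriv j (partial_deriv i f) (x + s *\<^sub>R axis i 1 + t *\<^sub>R axis j 1)"
proof -
  let ?a = "axis i 1 :: real ^ 'm" and ?b = "axis j 1 :: real ^ 'm"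
  have d0: "f differentiable (at y)" and d1: "partial_deriv i f differentiable (at y)" for y
    using smooth_differentiable[OF f, of "[]"] smooth_differentiable[OF f, of "[i]"] by simp_all
  \<comment> \<open>The mean value theorem is used twice: first in direction \<open>i\<close> on the
    increment of \<open>f\<close> in direction \<open>j\<close>, then in direction \<open>j\<close>
    on \<open>partial_deriv i f\<close>.\<close>
  have "((\<lambda>s. f ((x + h *\<^sub>R ?b) + s *\<^sub>R ?a) - f (x + s *\<^sub>R ?a)) has_real_derivative
      partial_deriv i f ((x + h *\<^sub>R ?b) + s *\<^sub>R ?a) - partial_deriv i f (x + s *\<^sub>R ?a)) (at s)" for s
    by (intro DERIV_diff partial_deriv_along_axis d0)
  from MVT2[OF \<open>h > 0\<close> this] obtain s where s: "0 < s" "s < h"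
    "f (x + h *\<^sub>R ?b + h *\<^sub>R ?a) - f (x + h *\<^sub>R ?a) - (f (x + h *\<^sub>R ?b) - f x) =
      h * (partial_deriv i f (x + h *\<^sub>R ?b + s *\<^sub>R ?a) - partial_deriv i f (x + s *\<^sub>R ?a))"
    by auto
  have "((\<lambda>t. partial_deriv i f (x + s *\<^sub>R ?a + t *\<^sub>R ?b)) has_real_derivative
      partial_deriv j (partial_deriv i f) (x + s *\<^sub>R ?a + t *\<^sub>R ?b)) (at t)" for t
    by (intro partial_deriv_along_axis d1)
  from MVT2[OF \<open>h > 0\<close> this] obtain t where t: "0 < t" "t < h"
    "partial_deriv i f (x + s *\<^sub>R ?a + h *\<^sub>R ?b) - partial_deriv i f (x + s *\<^sub>R ?a) =
      h * partial_deriv j (partial_deriv i f) (x + s *\<^sub>R ?a + t *\<^sub>R ?b)"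
    by auto
  show thesis
    by (rule that[OF s(1,2) t(1,2)]) (use s(3) t(3) in \<open>simp add: ac_simps\<close>)
qed

lemma partial_deriv_commute:
  fixes f :: "real ^ 'm::finite \<Rightarrow> real"
  assumes f: "smooth f"
  shows "partial_deriv i (partial_deriv j f) = partial_deriv j (partial_deriv i f)"
proof
  fix x
  let ?a = "axis i 1 :: real ^ 'm" and ?b = "axis j 1 :: real ^ 'm"
  let ?F = "partial_deriv j (partial_deriv i f)" and ?G = "partial_deriv i (partial_deriv j f)"
  have cont: "isCont ?F x" "isCont ?G x"
    using smooth_differentiable[OF f, of "[j, i]"] smooth_differentiable[OF f, of "[i, j]"]
    by (auto intro: differentiable_imp_continuous_within)
  have "\<exists>s t s' t'. 0 < s \<and> s < h \<and> 0 < t \<and> t < h \<and> 0 < s' \<and> s' < h \<and> 0 < t' \<and> t' < h \<and>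
      ?F (x + s *\<^sub>R ?a + t *\<^sub>R ?b) = ?G (x + s' *\<^sub>R ?a + t' *\<^sub>R ?b)" if "h > 0" for h
  proof -
    from second_difference_mean_value[OF f that, of x i j] obtain s t where 1:
      "0 < s" "s < h" "0 < t" "t < h"
      "f (x + h *\<^sub>R ?a + h *\<^sub>R ?b) - f (x + h *\<^sub>R ?a) - f (x + h *\<^sub>R ?b) + f x
        = h * h * ?F (x + s *\<^sub>R ?a + t *\<^sub>R ?b)" by blast
    \<comment> \<open>Exchanging \<open>i\<close> and \<open>j\<close> makes the first displacement
      run along \<open>?b\<close>, hence the order \<open>t'\<close>, \<open>s'\<close> of the
      witnesses.\<close>
    from second_difference_mean_value[OF f that, of x j i] obtain t' s' where 2:
      "0 < t'" "t' < h" "0 < s'" "s' < h"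
      "f (x + h *\<^sub>R ?b + h *\<^sub>R ?a) - f (x + h *\<^sub>R ?b) - f (x + h *\<^sub>R ?a) + f x
        = h * h * ?G (x + t' *\<^sub>R ?b + s' *\<^sub>R ?a)" by blast
    have "h * h * ?F (x + s *\<^sub>R ?a + t *\<^sub>R ?b) = h * h * ?G (x + s' *\<^sub>R ?a + t' *\<^sub>R ?b)"
      using 1(5) 2(5) by (simp add: algebra_simps)
    with \<open>h > 0\<close> have "?F (x + s *\<^sub>R ?a + t *\<^sub>R ?b) = ?G (x + s' *\<^sub>R ?a + t' *\<^sub>R ?b)"
      by simp
    with 1(1-4) 2(1-4) show ?thesis by blast
  qed
  \<comment> \<open>With \<open>h = 1 / (n + 1)\<close> the chosen witnesses form four null
    sequences, and continuity at \<open>x\<close> then identifies the two mixed derivatives.\<close>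
  then have "\<forall>n. \<exists>s t s' t'. 0 < s \<and> s < inverse (real (Suc n)) \<and> 0 < t \<and>
      t < inverse (real (Suc n)) \<and>
      0 < s' \<and> s' < inverse (real (Suc n)) \<and> 0 < t' \<and> t' < inverse (real (Suc n)) \<and>
      ?F (x + s *\<^sub>R ?a + t *\<^sub>R ?b) = ?G (x + s' *\<^sub>R ?a + t' *\<^sub>R ?b)"
    by (intro allI) (simp only: positive_imp_inverse_positive of_nat_0_less_iff zero_less_Suc)
  then obtain s t s' t' where st: "\<And>n :: nat. 0 < s n \<and> s n < inverse (real (Suc n)) \<and>
      0 < t n \<and> t n < inverse (real (Suc n)) \<and>
      0 < s' n \<and> s' n < inverse (real (Suc n)) \<and> 0 < t' n \<and> t' n < inverse (real (Suc n)) \<and>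
      ?F (x + s n *\<^sub>R ?a + t n *\<^sub>R ?b) = ?G (x + s' n *\<^sub>R ?a + t' n *\<^sub>R ?b)"
    unfolding choice_iff by blast
  have null: "r \<longlonglongrightarrow> 0" if "\<And>n. 0 < r n \<and> r n < inverse (real (Suc n))" for r :: "nat \<Rightarrow> real"
    by (rule tendsto_sandwich[OF _ _ tendsto_const LIMSEQ_inverse_real_of_nat])
       (use that in \<open>auto intro!: always_eventually less_imp_le\<close>)
  have lim: "(\<lambda>n. H (x + p n *\<^sub>R ?a + q n *\<^sub>R ?b)) \<longlonglongrightarrow> H x"
    if "isCont H x" "p \<longlonglongrightarrow> 0" "q \<longlonglongrightarrow> 0" for H :: "real ^ 'm \<Rightarrow> real" and p q
  proof (rule isCont_tendsto_compose[OF that(1)])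
    have "(\<lambda>n. x + p n *\<^sub>R ?a + q n *\<^sub>R ?b) \<longlonglongrightarrow> x + 0 *\<^sub>R ?a + 0 *\<^sub>R ?b"
      by (intro tendsto_intros that)
    then show "(\<lambda>n. x + p n *\<^sub>R ?a + q n *\<^sub>R ?b) \<longlonglongrightarrow> x" by simp
  qed
  have "s \<longlonglongrightarrow> 0" "t \<longlonglongrightarrow> 0" "s' \<longlonglongrightarrow> 0" "t' \<longlonglongrightarrow> 0"
    using st by (intro null; blast)+
  then have "(\<lambda>n. ?F (x + s n *\<^sub>R ?a + t n *\<^sub>R ?b)) \<longlonglongrightarrow> ?F x"
    and "(\<lambda>n. ?G (x + s' n *\<^sub>R ?a + t' n *\<^sub>R ?b)) \<longlonglongrightarrow> ?G x"
    by (auto intro!: lim cont)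
  moreover have "?F (x + s n *\<^sub>R ?a + t n *\<^sub>R ?b) = ?G (x + s' n *\<^sub>R ?a + t' n *\<^sub>R ?b)" for n
    using st by blast
  ultimately show "?G x = ?F x"
    by (simp only: LIMSEQ_unique)
qed

text \<open>By duality the two minus signs cancel, and the symmetry on test functions carries
  over.\<close>

lemma distr_partial_commute:
  "distr_partial i (distr_partial j u) = distr_partial j (distr_partial i u)"
proof -
  have "test_partial i (test_partial j \<phi>) = test_partial j (test_partial i \<phi>)"
      for \<phi> :: "'a test_fun"
    by transfer (simp add: partial_deriv_commute)
  then show ?thesis
    by transfer simp
qed

text \<open>Each induction step adds a row and a column that cancel except for the diagonal entry.
  This collapses the square of the bosonic Dirac operator.\<close>

lemma sum_sum_anticommuting:
  fixes c :: "'i \<Rightarrow> 'i \<Rightarrow> 'a::ab_group_add"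
  assumes "finite S" and "\<And>i j. i \<in> S \<Longrightarrow> j \<in> S \<Longrightarrow> i \<noteq> j \<Longrightarrow> c i j = - c j i"
  shows "(\<Sum>i\<in>S. \<Sum>j\<in>S. c i j) = (\<Sum>i\<in>S. c i i)"
  using assms
proof (induction S)
  case (insert a S)
  have "(\<Sum>j\<in>S. c a j) = - (\<Sum>i\<in>S. c i a)"
    unfolding sum_negf[symmetric] by (rule sum.cong) (use insert.hyps insert.prems in blast)+
  moreover have "(\<Sum>i\<in>S. \<Sum>j\<in>S. c i j) = (\<Sum>i\<in>S. c i i)"
    by (rule insert.IH) (use insert.prems in blast)
  ultimately show ?case
    using insert.hyps by (simp add: sum.distrib)
qed simp

lemma self_neg_zero: "a = - a \<Longrightarrow> a = (0 :: 'a::real_vector)"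
  using scaleR_2[of a] by (simp add: eq_neg_iff_add_eq_0)

text \<open>Groups the fermionic indices into symplectic pairs.\<close>

lemma sum_double:
  fixes g :: "nat \<Rightarrow> 'a::comm_monoid_add"
  shows "(\<Sum>j = 1..2 * n. g j) = (\<Sum>j = 1..n. g (2 * j - 1) + g (2 * j))"
proof (induction n)
  case (Suc n)
  have "{1..2 * Suc n} = insert (2 * n + 2) (insert (2 * n + 1) {1..2 * n})" by auto
  with Suc show ?case by (simp add: add_ac)
qed simp

lemma linear_tensor_left: "linear (\<lambda>a. a \<otimes>\<^sub>t b)"
  and linear_tensor_right: "linear (\<lambda>b. a \<otimes>\<^sub>t b)"
  using bilinear_pure_tensor unfolding bilinear_def by blast+

lemmas tensor_right_simps =
  linear_0[OF linear_tensor_right] linear_add[OF linear_tensor_right]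
  linear_diff[OF linear_tensor_right] linear_neg[OF linear_tensor_right]
  linear_cmul[OF linear_tensor_right] linear_sum[OF linear_tensor_right]

lemmas tensor_left_simps =
  linear_0[OF linear_tensor_left] linear_add[OF linear_tensor_left]
  linear_diff[OF linear_tensor_left] linear_neg[OF linear_tensor_left]
  linear_cmul[OF linear_tensor_left] linear_sum[OF linear_tensor_left]

section \<open>Relations in the superalgebra\<close>

lemma presented_zeroI:
  "r \<in> relators \<Longrightarrow> presented_eq r 0"
  unfolding presented_eq_def diff_zero by (rule relators_in_ideal)

lemma generator_Odd_outside:
  assumes "i \<notin> {1..2 * LENGTH('n)}"
  shows "generator (Odd i) = (0 :: 'n::len0 grassmann)"
  using assms
  by transfer (rule presented_zeroI, unfold relators_grassmann_gen_def, blast)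

text \<open>Inside the range this is a relator; if one index lies outside, its generator vanishes
  and both sides are zero.\<close>

lemma generator_Odd_anticommute:
  "generator (Odd i) * generator (Odd j) =
      - (generator (Odd j) * generator (Odd i) :: 'n::len0 grassmann)"
proof (cases "i \<in> {1..2 * LENGTH('n)} \<and> j \<in> {1..2 * LENGTH('n)}")
  case True
  then have "generator (Odd i) * generator (Odd j) + generator (Odd j) * generator (Odd i) =
      (0 :: 'n grassmann)"
    by transfer (rule presented_zeroI, unfold relators_grassmann_gen_def, blast)
  then show ?thesis by (rule eq_neg_iff_add_eq_0[THEN iffD2])
next
  case False
  then have "generator (Odd i) = (0 :: 'n grassmann) \<or> generator (Odd j) = (0 :: 'n grassmann)"
    using generator_Odd_outside by blast
  then show ?thesis by auto
qed

lemma generator_Ortho_anticommutator: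
  "generator (Ortho i) * generator (Ortho j) + generator (Ortho j) * generator (Ortho i)
    - (if i = j then - 2 else 0) *\<^sub>R 1 = (0 :: ('m, 'n::len0) clifford)"
  by transfer (rule presented_zeroI, unfold relators_clifford_gen_def, blast)

lemma generator_Ortho_anticommute:
  assumes "i \<noteq> j"
  shows "generator (Ortho i) * generator (Ortho j) =
    - (generator (Ortho j) * generator (Ortho i) :: ('m, 'n::len0) clifford)"
  using generator_Ortho_anticommutator[of i j] assms by (simp add: eq_neg_iff_add_eq_0)

text \<open>The diagonal relator determines twice the square, and the factor two is cancelled as a
  real scalar.\<close>

lemma generator_Ortho_square:
  "generator (Ortho i) * generator (Ortho i) = (- 1 :: ('m, 'n::len0) clifford)"
proof -
  have "2 *\<^sub>R (generator (Ortho i) * generator (Ortho i)) = 2 *\<^sub>R (- 1 :: ('m, 'n) clifford)"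
    using generator_Ortho_anticommutator[of i i]
    by (simp add: scaleR_2 eq_neg_iff_add_eq_0[symmetric] add_eq_0_iff)
  then show ?thesis by (simp only: scaleR_cancel_left) simp
qed

lemma generator_Sympl_outside:
  assumes "k \<notin> {1..2 * LENGTH('n)}"
  shows "generator (Sympl k) = (0 :: ('m, 'n::len0) clifford)"
  using assms
  by transfer (rule presented_zeroI, unfold relators_clifford_gen_def, blast)

lemma generator_Ortho_Sympl:
  "generator (Ortho i) * generator (Sympl k) =
    - (generator (Sympl k) * generator (Ortho i) :: ('m, 'n::len0) clifford)"
proof (cases "k \<in> {1..2 * LENGTH('n)}")
  case True
  then have "generator (Ortho i) * generator (Sympl k) + generator (Sympl k) * generator (Ortho i)
      = (0 :: ('m, 'n::len0) clifford)"
    by transfer (rule presented_zeroI, unfold relators_clifford_gen_def, blast)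
  then show ?thesis by (rule eq_neg_iff_add_eq_0[THEN iffD2])
qed (simp add: generator_Sympl_outside)

text \<open>Two families of relators are merged by the parity of \<open>k\<close>, so that
  commutators with the vector variable can be summed over a single range.\<close>

lemma generator_Sympl_odd_commutator:
  assumes j: "j \<in> {1..LENGTH('n)}" and k: "k \<in> {1..2 * LENGTH('n)}"
  shows "generator (Sympl (2 * j - 1)) * generator (Sympl k)
      - generator (Sympl k) * generator (Sympl (2 * j - 1))
    = (if k = 2 * j then 1 else 0 :: ('m, 'n::len0) clifford)"
proof (cases "even k")
  case True
  then obtain i where i: "k = 2 * i" by blast
  with k have "i \<in> {1..LENGTH('n)}" by auto
  have "generator (Sympl (2 * j - 1)) * generator (Sympl (2 * i))
      - generator (Sympl (2 * i)) * generator (Sympl (2 * j - 1))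
      - (if j = i then 1 else 0) *\<^sub>R 1 = (0 :: ('m, 'n) clifford)"
    using j \<open>i \<in> _\<close>
    by transfer (rule presented_zeroI, unfold relators_clifford_gen_def, blast)
  then show ?thesis using i by auto
next
  case False
  \<comment> \<open>An odd \<open>k\<close> is \<open>2 * i - 1\<close> for
    \<open>i = Suc (k div 2)\<close>.\<close>
  with k obtain i where i: "k = 2 * i - 1" "i \<in> {1..LENGTH('n)}"
    by (auto elim!: oddE intro!: that[of "Suc (k div 2)"])
  have "generator (Sympl (2 * j - 1)) * generator (Sympl (2 * i - 1))
      - generator (Sympl (2 * i - 1)) * generator (Sympl (2 * j - 1))
      = (0 :: ('m, 'n) clifford)"
    using j \<open>i \<in> _\<close>
    by transfer (rule presented_zeroI, unfold relators_clifford_gen_def, blast)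
  moreover have "k \<noteq> 2 * j" using False by auto
  ultimately show ?thesis using i by simp
qed

lemma generator_Sympl_even_commutator:
  assumes j: "j \<in> {1..LENGTH('n)}" and k: "k \<in> {1..2 * LENGTH('n)}"
  shows "generator (Sympl (2 * j)) * generator (Sympl k)
      - generator (Sympl k) * generator (Sympl (2 * j))
    = (if k = 2 * j - 1 then - 1 else 0 :: ('m, 'n::len0) clifford)"
proof (cases "even k")
  case True
  then obtain i where i: "k = 2 * i" by blast
  with k have "i \<in> {1..LENGTH('n)}" by auto
  have "generator (Sympl (2 * j)) * generator (Sympl (2 * i))
      - generator (Sympl (2 * i)) * generator (Sympl (2 * j))
      = (0 :: ('m, 'n) clifford)"
    using j \<open>i \<in> _\<close>
    by transfer (rule presented_zeroI, unfold relators_clifford_gen_def, blast)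
  moreover have "k \<noteq> 2 * j - 1" using True j by auto
  ultimately show ?thesis using i by simp
next
  case False
  with k obtain i where i: "k = 2 * i - 1" "i \<in> {1..LENGTH('n)}"
    by (auto elim!: oddE intro!: that[of "Suc (k div 2)"])
  \<comment> \<open>The mixed relation is reused with its two generators exchanged, which reverses
    the sign.\<close>
  from generator_Sympl_odd_commutator[OF i(2), of "2 * j", where 'm = 'm] j
  have "generator (Sympl k) * generator (Sympl (2 * j))
      - generator (Sympl (2 * j)) * generator (Sympl k)
      = (if j = i then 1 else 0 :: ('m, 'n) clifford)"
    using i by simp
  moreover have "k = 2 * j - 1 \<longleftrightarrow> j = i" using i j by auto
  ultimately show ?thesis
    by (metis (no_types, lifting) minus_diff_eq minus_zero)
qed

section \<open>Sign rules in the superalgebra\<close>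

lemma commute_mult_commute:
  fixes a b c :: "'a::real_algebra"
  assumes "a * b = b * a" "a * c = c * a"
  shows "a * (b * c) = b * c * a"
proof -
  have "a * (b * c) = (a * b) * c" by (simp only: mult.assoc)
  also have "\<dots> = b * (a * c)" by (simp only: assms(1) mult.assoc)
  finally show ?thesis by (simp only: assms(2) mult.assoc)
qed

lemma anticommute_mult_commute:
  fixes a b c :: "'a::real_algebra"
  assumes "a * b = - (b * a)" "a * c = c * a"
  shows "a * (b * c) = - (b * c * a)"
proof -
  have "a * (b * c) = (a * b) * c" by (simp only: mult.assoc)
  also have "\<dots> = - (b * (a * c))" by (simp only: assms(1) mult.assoc mult_minus_left)
  finally show ?thesis by (simp only: assms(2) mult.assoc)
qed

lemma anticommute_mult_anticommute:
  fixes a b c :: "'a::real_algebra"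
  assumes "a * b = - (b * a)" "a * c = - (c * a)"
  shows "a * (b * c) = b * c * a"
proof -
  have "a * (b * c) = (a * b) * c" by (simp only: mult.assoc)
  also have "\<dots> = - (b * (a * c))" by (simp only: assms(1) mult.assoc mult_minus_left)
  finally show ?thesis by (simp only: assms(2) mult.assoc mult_minus_right minus_minus)
qed

lemma odd_var_anticommute: "odd_var i * odd_var j =
    - (odd_var j * odd_var i :: ('m, 'n::len0) superalg)"
  unfolding odd_var_def times_tensor_pure
  by (subst generator_Odd_anticommute) (simp add: tensor_left_simps)

lemma odd_var_square: "odd_var i * odd_var i = (0 :: ('m, 'n::len0) superalg)"
  by (rule self_neg_zero) (rule odd_var_anticommute)

lemma odd_var_sympl_e: "odd_var i * sympl_e j = (sympl_e j * odd_var i :: ('m, 'n::len0) superalg)"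
  by (simp add: odd_var_def sympl_e_def)

lemma ortho_e_anticommute:
  "i \<noteq> j \<Longrightarrow> ortho_e i * ortho_e j = - (ortho_e j * ortho_e i :: ('m, 'n::len0) superalg)"
  unfolding ortho_e_def times_tensor_pure
  by (subst generator_Ortho_anticommute) (simp_all add: tensor_right_simps)

lemma ortho_e_square: "ortho_e i * ortho_e i = (- 1 :: ('m, 'n::len0) superalg)"
  by (simp add: ortho_e_def generator_Ortho_square tensor_right_simps one_tensor_def)

lemma ortho_e_sympl_e: "ortho_e i * sympl_e j =
    - (sympl_e j * ortho_e i :: ('m, 'n::len0) superalg)"
  unfolding ortho_e_def sympl_e_def times_tensor_pure
  by (subst generator_Ortho_Sympl) (simp add: tensor_right_simps)

lemma sympl_e_odd_commutator:
  assumes "j \<in> {1..LENGTH('n)}" and "k \<in> {1..2 * LENGTH('n)}"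
  shows "sympl_e (2 * j - 1) * sympl_e k - sympl_e k * sympl_e (2 * j - 1)
    = (if k = 2 * j then 1 else 0 :: ('m, 'n::len0) superalg)"
  unfolding sympl_e_def times_tensor_pure tensor_right_simps(3)[symmetric]
    generator_Sympl_odd_commutator[OF assms] mult_1_left
  by (simp add: one_tensor_def tensor_right_simps)

lemma sympl_e_even_commutator:
  assumes "j \<in> {1..LENGTH('n)}" and "k \<in> {1..2 * LENGTH('n)}"
  shows "sympl_e (2 * j) * sympl_e k - sympl_e k * sympl_e (2 * j)
    = (if k = 2 * j - 1 then - 1 else 0 :: ('m, 'n::len0) superalg)"
  unfolding sympl_e_def times_tensor_pure tensor_right_simps(3)[symmetric]
    generator_Sympl_even_commutator[OF assms] mult_1_left
  by (simp add: one_tensor_def tensor_right_simps)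

section \<open>The fermionic Dirac operator on powers of the vector variable\<close>

text \<open>The action of \<open>partial_odd\<close> on the superalgebra factor alone.\<close>

definition odd_deriv :: "nat \<Rightarrow> ('m, 'n::len0) superalg \<Rightarrow> ('m, 'n) superalg" where
  "odd_deriv j = tensor_map (grassmann_deriv j) (\<lambda>c. c)"

lemma linear_odd_deriv: "linear (odd_deriv j)"
  unfolding odd_deriv_def by (rule linear_tensor_map)

lemmas odd_deriv_linear_simps =
  linear_0[OF linear_odd_deriv] linear_add[OF linear_odd_deriv]
  linear_diff[OF linear_odd_deriv] linear_neg[OF linear_odd_deriv]
  linear_cmul[OF linear_odd_deriv] linear_sum[OF linear_odd_deriv]

lemma odd_deriv_pure: "odd_deriv j (a \<otimes>\<^sub>t b) = grassmann_deriv j a \<otimes>\<^sub>t b"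
  unfolding odd_deriv_def by (rule tensor_map_pure[OF linear_grassmann_deriv linear_ident])

lemma odd_deriv_one: "odd_deriv j (1 :: ('m, 'n::len0) superalg) = 0"
  by (simp add: one_tensor_def odd_deriv_pure grassmann_deriv_one tensor_left_simps)

lemma odd_deriv_odd_var_mult:
  assumes "j \<in> {1..2 * LENGTH('n)}"
  shows "odd_deriv j (odd_var k * F) =
    (if j = k then F else 0) - odd_var k * odd_deriv j (F :: ('m, 'n::len0) superalg)"
proof (rule linear_eq_tensor[where f = "\<lambda>F. odd_deriv j (odd_var k * F)"])
  show "linear (\<lambda>F. odd_deriv j (odd_var k * F) :: ('m, 'n) superalg)"
    by (rule linearI) (simp_all add: odd_deriv_linear_simps distrib_left)
  show "linear (\<lambda>F. (if j = k then F else 0) - odd_var k * odd_deriv j F :: ('m, 'n) superalg)"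
    by (rule linearI) (simp_all add: odd_deriv_linear_simps distrib_left scaleR_diff_right)
  show "odd_deriv j (odd_var k * (a \<otimes>\<^sub>t b)) =
      (if j = k then a \<otimes>\<^sub>t b else 0) - odd_var k * odd_deriv j (a \<otimes>\<^sub>t b :: ('m, 'n) superalg)" for a b
    by (simp add: odd_var_def odd_deriv_pure grassmann_deriv_gen_mult[OF assms] tensor_left_simps)
qed

lemma odd_deriv_clifford_mult:
  "odd_deriv j ((1 \<otimes>\<^sub>t c) * F) = (1 \<otimes>\<^sub>t c) * odd_deriv j (F :: ('m, 'n::len0) superalg)"
proof (rule linear_eq_tensor[where f = "\<lambda>F. odd_deriv j ((1 \<otimes>\<^sub>t c) * F)"])
  show "linear (\<lambda>F. odd_deriv j ((1 \<otimes>\<^sub>t c) * F) :: ('m, 'n) superalg)"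
    by (rule linearI) (simp_all add: odd_deriv_linear_simps distrib_left)
  show "linear (\<lambda>F. (1 \<otimes>\<^sub>t c) * odd_deriv j F :: ('m, 'n) superalg)"
    by (rule linearI) (simp_all add: odd_deriv_linear_simps distrib_left)
qed (simp add: odd_deriv_pure)

lemma odd_deriv_sympl_e_mult: "odd_deriv j (sympl_e k * F) = sympl_e k * odd_deriv j F"
  and odd_deriv_ortho_e_mult: "odd_deriv j (ortho_e i * F) = ortho_e i * odd_deriv j F"
  unfolding sympl_e_def ortho_e_def by (rule odd_deriv_clifford_mult)+

text \<open>The derivative passes the symplectic generators freely; it extracts the coefficient of
  \<open>odd_var a\<close> and changes sign on passing each odd variable.\<close>

lemma odd_deriv_fermionic_vec_mult:
  assumes "a \<in> {1..2 * LENGTH('n)}"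
  shows "odd_deriv a (fermionic_vec * F) =
    sympl_e a * F - fermionic_vec * odd_deriv a (F :: ('m, 'n::len0) superalg)"
proof -
  have "odd_deriv a (fermionic_vec * F) =
      (\<Sum>b = 1..2 * LENGTH('n). odd_deriv a (odd_var b * (sympl_e b * F)))"
    by (simp add: fermionic_vec_def sum_distrib_right odd_deriv_linear_simps mult.assoc)
  also have "\<dots> = (\<Sum>b = 1..2 * LENGTH('n). (if a = b then sympl_e b * F else 0)) -
      (\<Sum>b = 1..2 * LENGTH('n). odd_var b * (sympl_e b * odd_deriv a F))"
    by (simp add: odd_deriv_odd_var_mult[OF assms] odd_deriv_sympl_e_mult sum_subtractf)
  also have "\<dots> = sympl_e a * F - fermionic_vec * odd_deriv a F"
    using assms by (simp add: fermionic_vec_def sum_distrib_right mult.assoc)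
  finally show ?thesis .
qed

text \<open>Odd variables commute with symplectic generators and can be pulled out, leaving
  commutators inside the Clifford algebra.\<close>

lemma commutator_sympl_e_fermionic_vec:
  "sympl_e a * fermionic_vec - fermionic_vec * sympl_e a =
    (\<Sum>b = 1..2 * LENGTH('n).
      odd_var b * (sympl_e a * sympl_e b - sympl_e b * sympl_e a) :: ('m, 'n::len0) superalg)"
proof -
  have "sympl_e a * (odd_var b * sympl_e b) =
      odd_var b * (sympl_e a * sympl_e b :: ('m, 'n) superalg)" for b
    by (simp only: mult.assoc[symmetric] odd_var_sympl_e[symmetric])
  then show ?thesis
    by (simp add: fermionic_vec_def sum_distrib_right sum_distrib_left right_diff_distrib
        mult.assoc sum_subtractf)
qed

text \<open>In the commutator sum only the symplectic partner of the index survives.\<close>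

lemma sympl_e_odd_fermionic_vec:
  assumes "j \<in> {1..LENGTH('n)}"
  shows "sympl_e (2 * j - 1) * fermionic_vec =
    fermionic_vec * sympl_e (2 * j - 1) + (odd_var (2 * j) :: ('m, 'n::len0) superalg)"
proof -
  have "sympl_e (2 * j - 1) * fermionic_vec - fermionic_vec * sympl_e (2 * j - 1) =
      (\<Sum>b = 1..2 * LENGTH('n). if b = 2 * j then odd_var b else 0 :: ('m, 'n) superalg)"
    unfolding commutator_sympl_e_fermionic_vec
    by (rule sum.cong[OF refl], subst sympl_e_odd_commutator[OF assms]) simp_all
  also have "\<dots> = odd_var (2 * j)" using assms by simp
  finally show ?thesis by (simp add: algebra_simps)
qed

lemma sympl_e_even_fermionic_vec:
  assumes "j \<in> {1..LENGTH('n)}"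
  shows "sympl_e (2 * j) * fermionic_vec =
    fermionic_vec * sympl_e (2 * j) - (odd_var (2 * j - 1) :: ('m, 'n::len0) superalg)"
proof -
  have "sympl_e (2 * j) * fermionic_vec - fermionic_vec * sympl_e (2 * j) =
      (\<Sum>b = 1..2 * LENGTH('n). if b = 2 * j - 1 then - odd_var b else 0 :: ('m, 'n) superalg)"
    unfolding commutator_sympl_e_fermionic_vec
    by (rule sum.cong[OF refl], subst sympl_e_even_commutator[OF assms]) simp_all
  also have "\<dots> = - odd_var (2 * j - 1)"
  proof -
    have "2 * j - 1 \<in> {1..2 * LENGTH('n)}" using assms by auto
    then show ?thesis by simp
  qed
  finally show ?thesis by (simp add: algebra_simps)
qed

lemma odd_var_fermionic_vec: "odd_var c * fermionic_vec =
    - (fermionic_vec * odd_var c :: ('m, 'n::len0) superalg)"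
proof -
  have "odd_var c * (odd_var b * sympl_e b) =
      - (odd_var b * sympl_e b * odd_var c :: ('m, 'n) superalg)" for b
    by (rule anticommute_mult_commute[OF odd_var_anticommute odd_var_sympl_e])
  then show ?thesis
    by (simp add: fermionic_vec_def sum_distrib_right sum_distrib_left sum_negf)
qed

text \<open>Passing each of the two factors leaves the same odd variable up to a common sign. The
  two remainders cancel because that variable anticommutes with
  \<open>fermionic_vec\<close>.\<close>

lemma sympl_e_fermionic_vec_square:
  assumes "a \<in> {1..2 * LENGTH('n)}"
  shows "sympl_e a * (fermionic_vec * (fermionic_vec * F)) =
    fermionic_vec * (fermionic_vec * (sympl_e a * F :: ('m, 'n::len0) superalg))"
proof -
  have sq: "s * (f * (f * F)) = f * (f * (s * F))"
    if "s * f = f * s + x" "x * f = - (f * x)" for s x f :: "('m, 'n) superalg"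
  proof -
    have "s * (f * (f * F)) = (f * s + x) * (f * F)"
      by (simp only: that(1) mult.assoc[symmetric])
    also have "\<dots> = f * ((s * f) * F) + (x * f) * F"
      by (simp add: distrib_right mult.assoc)
    also have "\<dots> = f * (f * (s * F))"
      unfolding that by (simp add: distrib_right distrib_left mult.assoc)
    finally show ?thesis .
  qed
  show ?thesis
  proof (cases "even a")
    case True
    then obtain j where "a = 2 * j" by blast
    with assms sympl_e_even_fermionic_vec[of j, where 'm = 'm and 'n = 'n] show ?thesis
      by (intro sq[of _ _ "- odd_var (2 * j - 1)"]) (auto simp: odd_var_fermionic_vec)
  next
    case False
    with assms obtain j where "a = 2 * j - 1" "j \<in> {1..LENGTH('n)}"
      by (auto elim!: oddE intro!: that[of "Suc (a div 2)"])
    with sympl_e_odd_fermionic_vec[of j, where 'm = 'm and 'n = 'n] show ?thesis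
      by (intro sq[of _ _ "odd_var (2 * j)"]) (auto simp: odd_var_fermionic_vec)
  qed
qed

text \<open>The Clifford generators disappear, so the square is a sum of commuting elements of
  square zero and its powers can be computed.\<close>

lemma fermionic_vec_square:
  "fermionic_vec * fermionic_vec =
    (\<Sum>j = 1..LENGTH('n). odd_var (2 * j - 1) * odd_var (2 * j) :: ('m, 'n::len0) superalg)"
    (is "?f * ?f = ?\<theta>")
proof -
  have "?f * ?f = (\<Sum>b = 1..2 * LENGTH('n). odd_var b * (sympl_e b * ?f))"
    by (subst (1) fermionic_vec_def) (simp add: sum_distrib_right mult.assoc)
  moreover have "?f * ?f = (\<Sum>b = 1..2 * LENGTH('n). ?f * (odd_var b * sympl_e b))"
    by (subst (2) fermionic_vec_def) (simp add: sum_distrib_left)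
  moreover have "?f * (odd_var b * sympl_e b) = - (odd_var b * (?f * sympl_e b))" for b
    by (simp only: mult.assoc[symmetric] odd_var_fermionic_vec mult_minus_left minus_minus)
  \<comment> \<open>Doubling the square exposes the commutators of \<open>?f\<close> with the symplectic generators.\<close>
  ultimately have "?f * ?f + ?f * ?f =
      (\<Sum>b = 1..2 * LENGTH('n). odd_var b * (sympl_e b * ?f - ?f * sympl_e b))"
    by (simp add: right_diff_distrib sum_subtractf sum_negf)
  also have "\<dots> =
      (\<Sum>j = 1..LENGTH('n).
        odd_var (2 * j - 1) * odd_var (2 * j) + odd_var (2 * j) * - odd_var (2 * j - 1))"
    unfolding sum_double
    by (rule sum.cong[OF refl], subst sympl_e_odd_fermionic_vec, simp,
        subst sympl_e_even_fermionic_vec) simp_all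
  \<comment> \<open>Anticommuting the second product makes both members of a symplectic pair
    contribute the same term.\<close>
  also have "\<dots> = ?\<theta> + ?\<theta>"
    unfolding sum.distrib[symmetric] mult_minus_right
    by (simp only: odd_var_anticommute[of "2 * _"] minus_minus)
  finally have "2 *\<^sub>R (?f * ?f) = 2 *\<^sub>R ?\<theta>" by (simp only: scaleR_2)
  then show ?thesis by simp
qed

text \<open>The binomial theorem for commuting elements, cut off after the linear term. The exponent
  \<open>Suc p\<close> avoids truncated subtraction.\<close>

lemma power_Suc_add_nilpotent:
  fixes a b :: "'a::{real_algebra, monoid_mult}"
  assumes "a * b = b * a" "b * b = 0"
  shows "(a + b) ^ Suc p = a ^ Suc p + real (Suc p) *\<^sub>R (a ^ p * b)"
proof (induction p)
  case (Suc p)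
  have c: "b * a ^ q = a ^ q * b" for q
    using power_commuting_commutes[OF assms(1)] by simp
  have z: "b * (a ^ p * b) = 0"
    by (simp add: mult.assoc[symmetric] c) (simp add: mult.assoc assms(2))
  have "(a + b) ^ Suc (Suc p) = (a + b) * (a ^ Suc p + real (Suc p) *\<^sub>R (a ^ p * b))"
    unfolding power_Suc[of "a + b" "Suc p"] Suc ..
  also have "\<dots> = a ^ Suc (Suc p) + real (Suc p) *\<^sub>R (a ^ Suc p * b) + a ^ Suc p * b"
    by (simp add: distrib_right distrib_left c[of "Suc p", simplified] z mult.assoc)
  also have "\<dots> = a ^ Suc (Suc p) + real (Suc (Suc p)) *\<^sub>R (a ^ Suc p * b)"
  proof -
    have "real (Suc (Suc p)) = real (Suc p) + 1" by simp
    then show ?thesis by (simp only: scaleR_add_left scaleR_one add.assoc)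
  qed
  finally show ?case .
qed simp

text \<open>The two claims support each other: since the power \<open>Suc r\<close> vanishes, adding
  the next summand leaves only the linear binomial term, whose factor builds up the
  factorial.\<close>

lemma power_sum_square_zero:
  fixes y :: "nat \<Rightarrow> 'a::{real_algebra, monoid_mult}"
  assumes comm: "\<And>i j. y i * y j = y j * y i" and sq: "\<And>i. y i * y i = 0"
  shows "(\<Sum>j = 1..r. y j) ^ r = fact r *\<^sub>R prod_list (map y [1..<Suc r]) \<and>
    (\<Sum>j = 1..r. y j) ^ Suc r = 0"
proof (induction r)
  case (Suc r)
  let ?s = "\<Sum>j = 1..r. y j" and ?y = "y (Suc r)"
  have "?s * ?y = ?y * ?s"
    by (simp add: sum_distrib_left sum_distrib_right comm[of "Suc r"])
  note pow = power_Suc_add_nilpotent[OF this sq]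
  have s: "(\<Sum>j = 1..Suc r. y j) = ?s + ?y" by simp
  from Suc have p: "?s ^ r = fact r *\<^sub>R prod_list (map y [1..<Suc r])" and z1: "?s ^ Suc r = 0"
    by blast+
  have z2: "?s ^ Suc (Suc r) = 0"
    by (simp only: power_Suc[of _ "Suc r"] z1 mult_zero_right)
  have "(?s + ?y) ^ Suc r = real (Suc r) *\<^sub>R (fact r *\<^sub>R prod_list (map y [1..<Suc r]) * ?y)"
    unfolding pow z1 p by simp
  moreover have "(?s + ?y) ^ Suc (Suc r) = 0"
    unfolding pow z1 z2 by simp
  moreover have "prod_list (map y [1..<Suc (Suc r)]) = prod_list (map y [1..<Suc r]) * ?y"
    by simp
  ultimately show ?case
    unfolding s by (simp only: fact_Suc of_nat_mult scaleR_scaleR mult_scaleR_left of_nat_fact)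
qed simp

lemma prod_list_odd_var_pairs:
  "prod_list (map (\<lambda>j. odd_var (2 * j - 1) * odd_var (2 * j)) [1..<Suc r]) =
    prod_list (map odd_var [1..<2 * r + 1] :: ('m, 'n::len0) superalg list)"
proof (induction r)
  case (Suc r)
  have "[1..<2 * Suc r + 1] = [1..<2 * r + 1] @ [2 * r + 1, 2 * r + 2]"
    by (simp add: upt_rec[of "2 * r + 1"] flip: upt_add_eq_append)
  with Suc show ?case by (simp add: mult.assoc)
qed simp

text \<open>Connects the powers in \<open>super_odd\<close> with the product of all odd variables in
  \<open>super_delta\<close>. The summands of the square are even, hence commute, and square to
  zero.\<close>

lemma fermionic_vec_top_power:
  "fermionic_vec ^ (2 * LENGTH('n)) =
    fact (LENGTH('n)) *\<^sub>R
      (prod_list (map odd_var [1..<2 * LENGTH('n) + 1]) :: ('m, 'n::len0) superalg)"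
proof -
  let ?y = "\<lambda>j. odd_var (2 * j - 1) * odd_var (2 * j) :: ('m, 'n) superalg"
  have swap: "odd_var c * (odd_var a * odd_var b) =
      odd_var a * odd_var b * (odd_var c :: ('m, 'n) superalg)" for a b c
    by (rule anticommute_mult_anticommute[OF odd_var_anticommute odd_var_anticommute])
  have "?y i * ?y j = ?y j * ?y i" for i j
    by (rule commute_mult_commute[OF swap[symmetric] swap[symmetric]])
  moreover have "?y i * ?y i = 0" for i
  proof -
    have "?y i * ?y i = ?y i * odd_var (2 * i - 1) * odd_var (2 * i)"
      by (simp only: mult.assoc)
    \<comment> \<open>Moving the repeated variable in front of \<open>?y i\<close> produces the
      square of an odd variable.\<close>
    also have "\<dots> = odd_var (2 * i - 1) * ?y i * odd_var (2 * i)"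
      by (subst swap) (rule refl)
    also have "\<dots> = 0" by (simp add: mult.assoc[symmetric] odd_var_square)
    finally show ?thesis .
  qed
  ultimately have "(\<Sum>j = 1..LENGTH('n). ?y j) ^ LENGTH('n) =
      fact (LENGTH('n)) *\<^sub>R prod_list (map ?y [1..<Suc (LENGTH('n))])"
    using power_sum_square_zero[of ?y] by blast
  then show ?thesis
    unfolding power_mult power2_eq_square fermionic_vec_square prod_list_odd_var_pairs .
qed

section \<open>Recursion for the fermionic Dirac operator on powers\<close>

definition odd_dirac :: "('m, 'n::len0) superalg \<Rightarrow> ('m, 'n) superalg" where
  "odd_dirac F = 2 *\<^sub>R (\<Sum>j = 1..LENGTH('n).
     sympl_e (2 * j) * odd_deriv (2 * j - 1) F - sympl_e (2 * j - 1) * odd_deriv (2 * j) F)"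

lemma odd_dirac_one: "odd_dirac 1 = 0"
  by (simp add: odd_dirac_def odd_deriv_one)

text \<open>The sign comes from the symplectic generators in \<open>odd_dirac\<close>; the
  derivatives pass \<open>ortho_e i\<close> unchanged.\<close>

lemma odd_dirac_ortho_e_mult: "odd_dirac (ortho_e i * F) =
    - (ortho_e i * odd_dirac (F :: ('m, 'n::len0) superalg))"
proof -
  have "sympl_e a * (ortho_e i * G) = - (ortho_e i * (sympl_e a * G))"
      for a and G :: "('m, 'n) superalg"
    by (simp only: mult.assoc[symmetric] ortho_e_sympl_e mult_minus_left minus_minus)
  then show ?thesis
    by (simp add: odd_dirac_def odd_deriv_ortho_e_mult sum_distrib_left right_diff_distrib
        flip: scaleR_minus_right sum_negf)
qed

text \<open>Every symplectic pair contributes the commutator \<open>- 1\<close>. This is the source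
  of the dimension \<open>- 2 * n\<close>.\<close>

lemma odd_dirac_fermionic_vec:
  "odd_dirac (fermionic_vec :: ('m, 'n::len0) superalg) = (- 2 * real (LENGTH('n))) *\<^sub>R 1"
proof -
  have d: "odd_deriv a fermionic_vec = (sympl_e a :: ('m, 'n) superalg)"
      if "a \<in> {1..2 * LENGTH('n)}" for a
    using odd_deriv_fermionic_vec_mult[OF that, of 1] by (simp add: odd_deriv_one)
  have "(\<Sum>j = 1..LENGTH('n). sympl_e (2 * j) * odd_deriv (2 * j - 1) fermionic_vec
      - sympl_e (2 * j - 1) * odd_deriv (2 * j) fermionic_vec) =
          (\<Sum>j = 1..LENGTH('n). - 1 :: ('m, 'n) superalg)"
  proof (rule sum.cong[OF refl])
    fix j assume j: "j \<in> {1..LENGTH('n)}"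
    then have in_range: "2 * j \<in> {1..2 * LENGTH('n)}" "2 * j - 1 \<in> {1..2 * LENGTH('n)}" by auto
    show "sympl_e (2 * j) * odd_deriv (2 * j - 1) fermionic_vec
      - sympl_e (2 * j - 1) * odd_deriv (2 * j) fermionic_vec = (- 1 :: ('m, 'n) superalg)"
      unfolding in_range[THEN d] sympl_e_even_commutator[OF j in_range(2)] by simp
  qed
  then show ?thesis
    unfolding odd_dirac_def by (simp add: sum_constant_scaleR)
qed

text \<open>Raises the exponent by two. Symplectic generators pass the square, so the extra terms
  come only from differentiating it, and they reassemble to the vector variable.\<close>

lemma odd_dirac_fermionic_vec_square_mult:
  "odd_dirac (fermionic_vec * (fermionic_vec * F)) =
    2 *\<^sub>R (fermionic_vec * F)
        + fermionic_vec * (fermionic_vec * odd_dirac (F :: ('m, 'n::len0) superalg))"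
proof -
  let ?f = "fermionic_vec :: ('m, 'n) superalg" and ?n = "LENGTH('n)"
  have "(\<Sum>j = 1..?n. sympl_e (2 * j) * odd_deriv (2 * j - 1) (?f * (?f * F))
        - sympl_e (2 * j - 1) * odd_deriv (2 * j) (?f * (?f * F))) =
      (\<Sum>j = 1..?n. (odd_var (2 * j - 1) * sympl_e (2 * j - 1) * F
              + odd_var (2 * j) * sympl_e (2 * j) * F)
        + ?f * (?f * (sympl_e (2 * j) * odd_deriv (2 * j - 1) F
            - sympl_e (2 * j - 1) * odd_deriv (2 * j) F)))"
  proof (rule sum.cong[OF refl])
    fix j assume j: "j \<in> {1..?n}"
    let ?a = "2 * j - 1" and ?b = "2 * j"
    from j have r: "?a \<in> {1..2 * ?n}" "?b \<in> {1..2 * ?n}" by auto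
    \<comment> \<open>Applying the product rule twice leaves a commutator, which is the partner odd
      variable up to sign.\<close>
    have d: "odd_deriv c (?f * (?f * F)) =
        (sympl_e c * ?f - ?f * sympl_e c) * F + ?f * (?f * odd_deriv c F)" if "c \<in> {1..2 * ?n}"
            for c
      by (simp add: odd_deriv_fermionic_vec_mult[OF that] left_diff_distrib right_diff_distrib
          mult.assoc)
    have "odd_deriv ?a (?f * (?f * F)) = odd_var ?b * F + ?f * (?f * odd_deriv ?a F)"
      unfolding d[OF r(1)] sympl_e_odd_fermionic_vec[OF j] by simp
    moreover have "odd_deriv ?b (?f * (?f * F)) = - (odd_var ?a * F) + ?f * (?f * odd_deriv ?b F)"
      unfolding d[OF r(2)] sympl_e_even_fermionic_vec[OF j] by simp
    ultimately show "sympl_e ?b * odd_deriv ?a (?f * (?f * F))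
        - sympl_e ?a * odd_deriv ?b (?f * (?f * F)) =
        (odd_var ?a * sympl_e ?a * F + odd_var ?b * sympl_e ?b * F)
        + ?f * (?f * (sympl_e ?b * odd_deriv ?a F - sympl_e ?a * odd_deriv ?b F))"
      unfolding odd_var_sympl_e
      by (simp add: distrib_left right_diff_distrib sympl_e_fermionic_vec_square r[simplified]
          mult.assoc sympl_e_fermionic_vec_square[OF r(1)] sympl_e_fermionic_vec_square[OF r(2)])
  qed
  also have "\<dots> = ?f * F + ?f * (?f * (\<Sum>j = 1..?n.
      sympl_e (2 * j) * odd_deriv (2 * j - 1) F - sympl_e (2 * j - 1) * odd_deriv (2 * j) F))"
  proof -
    have "?f * F =
        (\<Sum>j = 1..?n. odd_var (2 * j - 1) * sympl_e (2 * j - 1) * F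
            + odd_var (2 * j) * sympl_e (2 * j) * F)"
      unfolding fermionic_vec_def sum_distrib_right by (rule sum_double)
    then show ?thesis by (simp add: sum.distrib sum_distrib_left)
  qed
  finally show ?thesis
    unfolding odd_dirac_def by (simp add: scaleR_add_right)
qed

text \<open>For \<open>s = 0\<close> the exponent \<open>2 * s - 1\<close> is truncated to
  \<open>0\<close>, but the coefficient is zero; the case split on \<open>s\<close> in the induction
  step reflects this.\<close>

lemma odd_dirac_even_power:
  "odd_dirac (fermionic_vec ^ (2 * s)) =
      (2 * real s) *\<^sub>R (fermionic_vec ^ (2 * s - 1) :: ('m, 'n::len0) superalg)"
proof (induction s)
  case (Suc s)
  let ?f = "fermionic_vec :: ('m, 'n) superalg"
  have "odd_dirac (?f ^ (2 * Suc s)) = 2 *\<^sub>R (?f * ?f ^ (2 * s))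
      + ?f * (?f * odd_dirac (?f ^ (2 * s)))"
    using odd_dirac_fermionic_vec_square_mult[of "?f ^ (2 * s)"] by simp
  also have "?f * (?f * odd_dirac (?f ^ (2 * s))) = (2 * real s) *\<^sub>R ?f ^ (2 * s + 1)"
    unfolding Suc by (cases s) simp_all
  finally show ?case by (simp flip: scaleR_add_left)
qed (simp add: odd_dirac_one)

text \<open>The same recursion adds \<open>2\<close> per step, now starting from the value
  \<open>- 2 * n\<close> at the first power.\<close>

lemma odd_dirac_odd_power:
  "odd_dirac (fermionic_vec ^ (2 * s + 1)) =
    (2 * real s - 2 * real (LENGTH('n))) *\<^sub>R (fermionic_vec ^ (2 * s) :: ('m, 'n::len0) superalg)"
proof (induction s)
  case (Suc s)
  let ?f = "fermionic_vec :: ('m, 'n) superalg"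
  have "odd_dirac (?f ^ (2 * Suc s + 1)) =
      2 *\<^sub>R (?f * ?f ^ (2 * s + 1)) + ?f * (?f * odd_dirac (?f ^ (2 * s + 1)))"
    using odd_dirac_fermionic_vec_square_mult[of "?f ^ (2 * s + 1)"] by simp
  also have "\<dots> = (2 * real (Suc s) - 2 * real (LENGTH('n))) *\<^sub>R ?f ^ (2 * Suc s)"
    unfolding Suc by (simp flip: scaleR_add_left)
  finally show ?case .
qed (simp add: odd_dirac_fermionic_vec)

section \<open>The super Dirac operator on pure tensors\<close>

lemma linear_super_dirac: "linear (super_dirac :: ('m::finite, 'n::len0) superdistr \<Rightarrow> _)"
  and linear_bosonic_dirac: "linear (bosonic_dirac :: ('m::finite, 'n::len0) superdistr \<Rightarrow> _)"
proof -
  have lmult: "linear (\<lambda>T. a \<cdot>\<^sub>l f T)" if "linear f" for a and f :: "('m, 'n) superdistr \<Rightarrow> _"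
    using linear_compose[OF that linear_tensor_map] unfolding lmult_def o_def .
  have x: "linear (partial_x j)" and odd: "linear (partial_odd i)" for j :: 'm and i
    unfolding partial_x_def partial_odd_def by (rule linear_tensor_map)+
  show bos: "linear (bosonic_dirac :: ('m, 'n) superdistr \<Rightarrow> _)"
    unfolding bosonic_dirac_def[abs_def] by (intro linear_compose_sum ballI lmult x)
  have "linear (fermionic_dirac :: ('m, 'n) superdistr \<Rightarrow> _)"
    unfolding fermionic_dirac_def[abs_def]
    by (intro linear_compose_scale_right linear_compose_sum ballI linear_compose_sub lmult odd)
  then show "linear (super_dirac :: ('m, 'n) superdistr \<Rightarrow> _)"
    unfolding super_dirac_def[abs_def] by (intro linear_compose_sub bos)
qed

lemma lmult_pure: "a \<cdot>\<^sub>l (u \<otimes>\<^sub>t F) = u \<otimes>\<^sub>t (a * F)"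
  unfolding lmult_def by (rule tensor_map_pure[OF linear_ident linear_mult_left])

lemma rmult_pure: "(u \<otimes>\<^sub>t F) \<cdot>\<^sub>r a = u \<otimes>\<^sub>t (F * a)"
  unfolding rmult_def by (rule tensor_map_pure[OF linear_ident linear_mult_right])

lemma partial_x_pure: "partial_x j (u \<otimes>\<^sub>t F) = distr_partial j u \<otimes>\<^sub>t F"
  unfolding partial_x_def by (rule tensor_map_pure[OF linear_distr_partial linear_ident])

lemma partial_odd_pure: "partial_odd j (u \<otimes>\<^sub>t F) = u \<otimes>\<^sub>t odd_deriv j F"
  unfolding partial_odd_def odd_deriv_def
  by (rule tensor_map_pure[OF linear_ident linear_tensor_map])

lemma fermionic_dirac_pure: "fermionic_dirac (u \<otimes>\<^sub>t F) = u \<otimes>\<^sub>t odd_dirac F"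
  unfolding fermionic_dirac_def odd_dirac_def partial_odd_pure lmult_pure tensor_right_simps ..

lemma bosonic_dirac_pure: "bosonic_dirac (u \<otimes>\<^sub>t F) = (\<Sum>j\<in>UNIV. distr_partial j u \<otimes>\<^sub>t (ortho_e j * F))"
  unfolding bosonic_dirac_def partial_x_pure lmult_pure ..

text \<open>The two operators differentiate in different tensor factors; the sign is that of
  \<open>odd_dirac_ortho_e_mult\<close>.\<close>

lemma fermionic_bosonic_dirac_pure:
  "fermionic_dirac (bosonic_dirac (u \<otimes>\<^sub>t F)) =
      - bosonic_dirac (u \<otimes>\<^sub>t odd_dirac (F :: ('m::finite, 'n::len0) superalg))"
proof -
  \<comment> \<open>The fermionic operator is the sum of the super and the bosonic Dirac operators,
    whose linearity is known.\<close>
  have lin: "linear (fermionic_dirac :: ('m, 'n) superdistr \<Rightarrow> _)"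
    using linear_compose_add[OF linear_super_dirac linear_bosonic_dirac]
    by (simp add: super_dirac_def[abs_def])
  show ?thesis
    by (simp add: linear_sum[OF lin] bosonic_dirac_pure fermionic_dirac_pure
        odd_dirac_ortho_e_mult tensor_right_simps sum_negf)
qed

text \<open>Symmetric second derivatives against anticommuting generators remove the mixed terms;
  the squares \<open>- 1\<close> on the diagonal give the sign in
  \<open>bosonic_laplace\<close>.\<close>

lemma bosonic_dirac_square_pure:
  "bosonic_dirac (bosonic_dirac (u \<otimes>\<^sub>t F)) =
      bosonic_laplace u \<otimes>\<^sub>t (F :: ('m::finite, 'n::len0) superalg)"
proof -
  let ?c = "\<lambda>j i. distr_partial i (distr_partial j u) \<otimes>\<^sub>t (ortho_e i * (ortho_e j * F))"
  have "bosonic_dirac (bosonic_dirac (u \<otimes>\<^sub>t F)) = (\<Sum>j\<in>UNIV. \<Sum>i\<in>UNIV. ?c j i)"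
    by (simp add: bosonic_dirac_pure linear_sum[OF linear_bosonic_dirac])
  also have "\<dots> = (\<Sum>i\<in>UNIV. ?c i i)"
  proof (rule sum_sum_anticommuting)
    fix i j :: 'm assume "i \<noteq> j"
    then have "ortho_e i * (ortho_e j * F) = - (ortho_e j * (ortho_e i * F))"
      by (simp only: mult.assoc[symmetric] ortho_e_anticommute[of i j] mult_minus_left
          not_False_eq_True)
    then show "?c i j = - ?c j i"
      by (simp add: distr_partial_commute[of i j] tensor_right_simps)
  qed simp
  also have "\<dots> = (\<Sum>i\<in>UNIV. - (distr_partial i (distr_partial i u) \<otimes>\<^sub>t F))"
    by (simp add: mult.assoc[symmetric] ortho_e_square tensor_right_simps)
  finally show ?thesis
    by (simp add: bosonic_laplace_def tensor_left_simps sum_negf)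
qed

lemma super_dirac_pure:
  "super_dirac (u \<otimes>\<^sub>t F) = u \<otimes>\<^sub>t odd_dirac F - bosonic_dirac (u \<otimes>\<^sub>t F)"
  by (simp add: super_dirac_def fermionic_dirac_pure)

lemma super_dirac_bosonic_dirac_pure:
  "super_dirac (bosonic_dirac (u \<otimes>\<^sub>t F)) =
    - bosonic_dirac (u \<otimes>\<^sub>t odd_dirac F) - bosonic_laplace u \<otimes>\<^sub>t F"
  by (simp add: super_dirac_def fermionic_bosonic_dirac_pure bosonic_dirac_square_pure)

section \<open>Fundamental solutions\<close>

text \<open>The coefficients of the second sum in \<open>super_odd\<close>; those of the first carry
  the extra factor \<open>2 * (n - l)\<close>.\<close>

definition odd_coeff :: "nat \<Rightarrow> nat \<Rightarrow> nat \<Rightarrow> real" where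
  "odd_coeff n k l = 4 ^ l * fact (l + k) / (fact (n - l) * fact k)"

definition super_even :: "(nat \<Rightarrow> 'm::finite distr) \<Rightarrow> nat \<Rightarrow> ('m, 'n::len0) superdistr" where
  "super_even \<nu> k = (\<Sum>l\<le>LENGTH('n). odd_coeff (LENGTH('n)) k l *\<^sub>R
     (\<nu> (2 * (l + k) + 2) \<otimes>\<^sub>t fermionic_vec ^ (2 * (LENGTH('n) - l))))"

lemma odd_coeff_shift_fact:
  assumes "l < n"
  shows "2 * (4 ^ l * fact (l + k) / (fact (n - l - 1) * fact k)) =
      odd_coeff n k l * (2 * real (n - l))"
proof -
  have "fact (n - l) = real (n - l) * fact (n - l - 1)"
    using assms by (simp add: fact_reduce del: of_nat_diff)
  then show ?thesis using assms by (simp add: odd_coeff_def del: of_nat_diff)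
qed

text \<open>The telescoping identity. The factor \<open>2 * real (n - l)\<close> belongs to the
  first sum of \<open>super_odd\<close>, \<open>2 * real (Suc l)\<close> comes from the odd power
  rule, and the two factors \<open>2\<close> supply the next power of \<open>4\<close>.\<close>

lemma odd_coeff_Suc:
  assumes "l < n"
  shows "odd_coeff n k l * (2 * real (n - l)) * (2 * real (Suc l)) * real (Suc l + k) =
    odd_coeff n k (Suc l) * real (Suc l)"
proof -
  have "fact (n - l) = real (n - l) * fact (n - Suc l)"
    using assms fact_reduce[of "n - l", where 'a = real] by (simp del: of_nat_diff)
  then show ?thesis using assms by (simp add: odd_coeff_def field_simps del: of_nat_Suc of_nat_diff)
qed

lemma odd_coeff_pred: "odd_coeff n (Suc k) l * real (Suc k) = odd_coeff n k l * real (l + Suc k)"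
  by (simp add: odd_coeff_def field_simps del: of_nat_Suc of_nat_add)

text \<open>\<open>bosonic_dirac\<close> multiplies from the left, so the right factor can be moved
  inside; the summands become pure tensors and their images.\<close>

lemma super_odd_pure:
  "super_odd \<nu> k = (let n = LENGTH('n); f = (fermionic_vec :: ('m::finite, 'n::len0) superalg) in
     (\<Sum>l<n. (odd_coeff n k l * (2 * real (n - l))) *\<^sub>R (\<nu> (2 * (l + k) + 2) \<otimes>\<^sub>t f ^ (2 * (n - l) - 1)))
     - (\<Sum>l\<le>n. odd_coeff n k l *\<^sub>R bosonic_dirac (\<nu> (2 * (l + k) + 2) \<otimes>\<^sub>t f ^ (2 * (n - l)))))"
proof -
  have "bosonic_dirac (u \<otimes>\<^sub>t 1) \<cdot>\<^sub>r F = bosonic_dirac (u \<otimes>\<^sub>t F)" for u :: "'m distr"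
      and F :: "('m, 'n) superalg"
  proof -
    have lin: "linear (\<lambda>T. T \<cdot>\<^sub>r F)" unfolding rmult_def by (rule linear_tensor_map)
    show ?thesis by (simp add: linear_sum[OF lin] bosonic_dirac_pure rmult_pure)
  qed
  then show ?thesis
    unfolding super_odd_def Let_def bosonic_odd_def embed_distr_def
    by (intro arg_cong2[where f = "(-)"] sum.cong refl)
       (simp_all only: lessThan_iff odd_coeff_shift_fact rmult_pure mult_1_left diff_mult_distrib2
          distrib_left
          odd_coeff_def[symmetric])
qed

lemma super_dirac_super_even: "super_dirac (super_even \<nu> k) =
    (super_odd \<nu> k :: ('m::finite, 'n::len0) superdistr)"
proof -
  let ?n = "LENGTH('n)" and ?f = "fermionic_vec :: ('m, 'n) superalg"
  let ?u = "\<lambda>l. \<nu> (2 * (l + k) + 2)"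
  have "super_dirac (super_even \<nu> k :: ('m, 'n) superdistr) = (\<Sum>l\<le>?n.
      (odd_coeff ?n k l * (2 * real (?n - l))) *\<^sub>R (?u l \<otimes>\<^sub>t ?f ^ (2 * (?n - l) - 1)) -
      odd_coeff ?n k l *\<^sub>R bosonic_dirac (?u l \<otimes>\<^sub>t ?f ^ (2 * (?n - l))))"
    unfolding super_even_def
    by (simp add: linear_sum[OF linear_super_dirac] linear_cmul[OF linear_super_dirac]
        super_dirac_pure odd_dirac_even_power tensor_right_simps scaleR_diff_right)
  \<comment> \<open>At \<open>l = ?n\<close> the factor \<open>?n - l\<close> is zero, which
    shortens the first sum to \<open>l < n\<close>.\<close>
  then show ?thesis
    unfolding super_odd_pure Let_def sum_subtractf by (simp add: lessThan_Suc_atMost[symmetric])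
qed

text \<open>The Laplacian terms of both sums combine with weight \<open>1 - l / (l + k)\<close>,
  that is \<open>k / (l + k)\<close>. This single formula serves both the descent in
  \<open>k\<close> and the final case \<open>k = 0\<close>.\<close>

lemma super_dirac_super_odd:
  fixes \<nu> :: "nat \<Rightarrow> 'm::finite distr"
  assumes step: "\<And>l. bosonic_laplace (\<nu> (2 * (Suc l + k) + 2)) = \<nu> (2 * (l + k) + 2)"
  shows "super_dirac (super_odd \<nu> k :: ('m, 'n::len0) superdistr) = (\<Sum>l\<le>LENGTH('n).
    (odd_coeff (LENGTH('n)) k l * (if l = 0 then 1 else real k / real (l + k))) *\<^sub>R
    (bosonic_laplace (\<nu> (2 * (l + k) + 2)) \<otimes>\<^sub>t fermionic_vec ^ (2 * (LENGTH('n) - l))))"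
proof -
  let ?n = "LENGTH('n)" and ?f = "fermionic_vec :: ('m, 'n) superalg"
  let ?u = "\<lambda>l. \<nu> (2 * (l + k) + 2)"
  let ?c = "\<lambda>l. odd_coeff ?n k l" and ?d = "\<lambda>l. odd_coeff ?n k l * (2 * real (?n - l))"
  let ?W = "\<lambda>l. bosonic_laplace (?u l) \<otimes>\<^sub>t ?f ^ (2 * (?n - l))"
  \<comment> \<open>By \<open>step\<close>, \<open>?u l\<close> is the Laplacian of
    \<open>?u (Suc l)\<close>, so the fermionic part is a multiple of
    \<open>?W (Suc l)\<close>.\<close>
  have even_part: "super_dirac (?u l \<otimes>\<^sub>t ?f ^ (2 * (?n - l) - 1)) =
      - (2 * real (Suc l)) *\<^sub>R ?W (Suc l) - bosonic_dirac (?u l \<otimes>\<^sub>t ?f ^ (2 * (?n - l) - 1))"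
    if "l < ?n" for l
  proof -
    have p: "2 * (?n - l) - 1 = 2 * (?n - Suc l) + 1" using that by simp
    have c: "2 * real (?n - Suc l) - 2 * real ?n = - (2 * real (Suc l))" using that by simp
    show ?thesis
      unfolding p super_dirac_pure odd_dirac_odd_power c step tensor_right_simps ..
  qed
  have odd_part: "super_dirac (bosonic_dirac (?u l \<otimes>\<^sub>t ?f ^ (2 * (?n - l)))) =
      - (2 * real (?n - l)) *\<^sub>R bosonic_dirac (?u l \<otimes>\<^sub>t ?f ^ (2 * (?n - l) - 1)) - ?W l" for l
    by (simp add: super_dirac_bosonic_dirac_pure odd_dirac_even_power tensor_right_simps
        linear_cmul[OF linear_bosonic_dirac])
  have "super_dirac (super_odd \<nu> k) =
      (\<Sum>l<?n. ?d l *\<^sub>R super_dirac (?u l \<otimes>\<^sub>t ?f ^ (2 * (?n - l) - 1)))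
      - (\<Sum>l\<le>?n. ?c l *\<^sub>R super_dirac (bosonic_dirac (?u l \<otimes>\<^sub>t ?f ^ (2 * (?n - l)))))"
    unfolding super_odd_pure Let_def
    by (simp only: linear_diff[OF linear_super_dirac] linear_sum[OF linear_super_dirac]
        linear_cmul[OF linear_super_dirac])
  also have "(\<Sum>l<?n. ?d l *\<^sub>R super_dirac (?u l \<otimes>\<^sub>t ?f ^ (2 * (?n - l) - 1))) =
      - (\<Sum>l<?n. (?d l * (2 * real (Suc l))) *\<^sub>R ?W (Suc l))
      - (\<Sum>l<?n. ?d l *\<^sub>R bosonic_dirac (?u l \<otimes>\<^sub>t ?f ^ (2 * (?n - l) - 1)))"
    unfolding sum_negf[symmetric] sum_subtractf[symmetric]
    by (rule sum.cong[OF refl]) (simp only: even_part lessThan_iff scaleR_diff_right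
        scaleR_minus_left scaleR_minus_right scaleR_scaleR)
  also have "(\<Sum>l\<le>?n. ?c l *\<^sub>R super_dirac (bosonic_dirac (?u l \<otimes>\<^sub>t ?f ^ (2 * (?n - l))))) =
      - (\<Sum>l\<le>?n. ?d l *\<^sub>R bosonic_dirac (?u l \<otimes>\<^sub>t ?f ^ (2 * (?n - l) - 1)))
      - (\<Sum>l\<le>?n. ?c l *\<^sub>R ?W l)"
    unfolding sum_negf[symmetric] sum_subtractf[symmetric]
    by (rule sum.cong[OF refl]) (simp only: odd_part scaleR_diff_right
        scaleR_minus_left scaleR_minus_right scaleR_scaleR)
  \<comment> \<open>The summand at \<open>l = ?n\<close> has coefficient zero, so the two bosonic
    sums agree and cancel.\<close>
  also have "(\<Sum>l\<le>?n. ?d l *\<^sub>R bosonic_dirac (?u l \<otimes>\<^sub>t ?f ^ (2 * (?n - l) - 1))) =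
      (\<Sum>l<?n. ?d l *\<^sub>R bosonic_dirac (?u l \<otimes>\<^sub>t ?f ^ (2 * (?n - l) - 1)))"
    by (simp add: lessThan_Suc_atMost[symmetric])
  finally have "super_dirac (super_odd \<nu> k) =
      (\<Sum>l\<le>?n. ?c l *\<^sub>R ?W l) - (\<Sum>l<?n. (?d l * (2 * real (Suc l))) *\<^sub>R ?W (Suc l))"
    by simp
  also have "(\<Sum>l<?n. (?d l * (2 * real (Suc l))) *\<^sub>R ?W (Suc l)) =
      (\<Sum>l<?n. (?c (Suc l) * (real (Suc l) / real (Suc l + k))) *\<^sub>R ?W (Suc l))"
  proof (rule sum.cong[OF refl])
    fix l assume "l \<in> {..<?n}"
    with odd_coeff_Suc[of l ?n k] have "?d l * (2 * real (Suc l)) =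
        ?c (Suc l) * (real (Suc l) / real (Suc l + k))"
      by (simp add: divide_simps del: of_nat_Suc of_nat_add)
    then show "(?d l * (2 * real (Suc l))) *\<^sub>R ?W (Suc l) =
        (?c (Suc l) * (real (Suc l) / real (Suc l + k))) *\<^sub>R ?W (Suc l)"
      by simp
  qed
  \<comment> \<open>The new summand at \<open>l = 0\<close> vanishes, so the shifted sum fills the
    whole range.\<close>
  also have "\<dots> = (\<Sum>l\<le>?n. (?c l * (real l / real (l + k))) *\<^sub>R ?W l)"
    unfolding lessThan_Suc_atMost[symmetric] sum.lessThan_Suc_shift by simp
  finally have "super_dirac (super_odd \<nu> k) =
      (\<Sum>l\<le>?n. ?c l *\<^sub>R ?W l - (?c l * (real l / real (l + k))) *\<^sub>R ?W l)"
    by (simp only: sum_subtractf)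
  also have "\<dots> = (\<Sum>l\<le>?n. (?c l * (if l = 0 then 1 else real k / real (l + k))) *\<^sub>R ?W l)"
  proof (rule sum.cong[OF refl])
    fix l
    \<comment> \<open>For \<open>l = 0\<close> and \<open>k = 0\<close> the quotient
      \<open>real k / real (l + k)\<close> is \<open>0\<close> by the convention on division by
      zero, whereas the weight is \<open>1\<close>; hence the conditional.\<close>
    have "?c l - ?c l * (real l / real (l + k)) =
        ?c l * (if l = 0 then 1 else real k / real (l + k))"
    proof (cases "l = 0")
      case False
      then have "real l / real (l + k) = 1 - real k / real (l + k)"
        by (simp add: divide_simps)
      with False show ?thesis by (simp only: right_diff_distrib mult_1_right if_False)
    qed simp
    then show "?c l *\<^sub>R ?W l - (?c l * (real l / real (l + k))) *\<^sub>R ?W l =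
        (?c l * (if l = 0 then 1 else real k / real (l + k))) *\<^sub>R ?W l"
      by (simp only: scaleR_diff_left[symmetric])
  qed
  finally show ?thesis .
qed

text \<open>The weight \<open>(k + 1) / (l + k + 1)\<close> turns the coefficients for
  \<open>Suc k\<close> into those for \<open>k\<close>, while the Laplacian lowers the index of
  every distribution.\<close>

lemma super_dirac_super_odd_Suc:
  fixes \<nu> :: "nat \<Rightarrow> 'm::finite distr"
  assumes "\<And>i. bosonic_laplace (\<nu> (2 * Suc i + 2)) = \<nu> (2 * i + 2)"
  shows "super_dirac (super_odd \<nu> (Suc k)) = (super_even \<nu> k :: ('m, 'n::len0) superdistr)"
proof -
  have lap: "bosonic_laplace (\<nu> (2 * (l + Suc k) + 2)) = \<nu> (2 * (l + k) + 2)" for l k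
    using assms[of "l + k"] by simp
  have step: "bosonic_laplace (\<nu> (2 * (Suc l + Suc k) + 2)) = \<nu> (2 * (l + Suc k) + 2)" for l
    using lap[of "Suc l" k] by simp
  have c: "odd_coeff n (Suc k) l * (if l = 0 then 1 else real (Suc k) / real (l + Suc k)) =
      odd_coeff n k l" for n l
    using odd_coeff_pred[of n k l]
    by (cases "l = 0") (simp_all add: divide_simps del: of_nat_Suc of_nat_add)
  show ?thesis
    unfolding super_dirac_super_odd[OF step] super_even_def c lap ..
qed

text \<open>For \<open>k = 0\<close> all weights with \<open>l > 0\<close> vanish. The term
  \<open>l = 0\<close> carries the top power, whose factorial cancels
  \<open>odd_coeff\<close>.\<close>

lemma super_dirac_super_odd_0:
  fixes \<nu> :: "nat \<Rightarrow> 'm::finite distr"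
  assumes "\<And>i. bosonic_laplace (\<nu> (2 * Suc i + 2)) = \<nu> (2 * i + 2)"
    and "bosonic_laplace (\<nu> 2) = dirac_delta"
  shows "super_dirac (super_odd \<nu> 0) = (super_delta :: ('m, 'n::len0) superdistr)"
proof -
  let ?n = "LENGTH('n)"
  have step: "bosonic_laplace (\<nu> (2 * (Suc l + 0) + 2)) = \<nu> (2 * (l + 0) + 2)" for l
    using assms(1)[of l] by simp
  have "super_dirac (super_odd \<nu> 0 :: ('m, 'n) superdistr) = (\<Sum>l\<le>?n. if l = 0 then
      odd_coeff ?n 0 0 *\<^sub>R (bosonic_laplace (\<nu> 2) \<otimes>\<^sub>t fermionic_vec ^ (2 * ?n)) else 0)"
    unfolding super_dirac_super_odd[OF step] by (rule sum.cong) (auto simp: numeral_2_eq_2)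
  also have "\<dots> = (1 / fact ?n) *\<^sub>R (dirac_delta \<otimes>\<^sub>t fermionic_vec ^ (2 * ?n))"
    by (simp add: assms(2) odd_coeff_def)
  also have "\<dots> = super_delta"
    unfolding fermionic_vec_top_power super_delta_def tensor_right_simps by simp
  finally show ?thesis .
qed

theorem theorem5:
  fixes \<nu> :: "nat \<Rightarrow> 'm::finite distr" and k :: nat
  assumes "\<And>l j. 1 \<le> l \<Longrightarrow> j < l \<Longrightarrow> (bosonic_laplace ^^ j) (\<nu> (2 * l)) = \<nu> (2 * l - 2 * j)"
    and "\<And>l. 1 \<le> l \<Longrightarrow> (bosonic_laplace ^^ l) (\<nu> (2 * l)) = dirac_delta"
  shows "(super_laplace ^^ k \<circ> super_dirac) (super_odd \<nu> k) =
           (super_delta :: ('m, 'n::len0) superdistr) \<and>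
         (super_laplace ^^ k \<circ> super_dirac :: ('m, 'n) superdistr \<Rightarrow> ('m, 'n) superdistr) =
           super_dirac ^^ (2 * k + 1)"
proof -
  have pow: "super_laplace ^^ k \<circ> super_dirac =
      (super_dirac ^^ (2 * k + 1) :: ('m, 'n) superdistr \<Rightarrow> ('m, 'n) superdistr)" for k
    unfolding super_laplace_def funpow_mult by (simp add: funpow_Suc_right mult.commute del: funpow.simps)
  \<comment> \<open>The hypothesis is used with \<open>j = 1\<close> and \<open>l = i + 2\<close>,
    so that \<open>j < l\<close> holds.\<close>
  have laplace: "bosonic_laplace (\<nu> (2 * Suc i + 2)) = \<nu> (2 * i + 2)" for i
    using assms(1)[of "Suc (Suc i)" 1] by simp
  have "(super_dirac ^^ (2 * k + 1)) (super_odd \<nu> k) = (super_delta :: ('m, 'n) superdistr)"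
  proof (induction k)
    case 0
    show ?case
      using super_dirac_super_odd_0[OF laplace] assms(2)[of 1] by simp
  next
    case (Suc k)
    \<comment> \<open>The two additional Dirac steps are moved innermost, where they lower
      \<open>Suc k\<close> to \<open>k\<close> by way of \<open>super_even\<close>.\<close>
    have "(super_dirac ^^ (2 * Suc k + 1)) (super_odd \<nu> (Suc k)) =
        (super_dirac ^^ (2 * k + 1)) (super_dirac (super_dirac (super_odd \<nu> (Suc k) :: ('m, 'n) superdistr)))"
      by (simp add: funpow_swap1)
    also have "\<dots> = (super_dirac ^^ (2 * k + 1)) (super_odd \<nu> k)"
      by (simp only: super_dirac_super_odd_Suc[OF laplace] super_dirac_super_even)
    finally show ?case using Suc by simp
  qed
  then show ?thesis unfolding pow by blast
qed

end
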